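(* Let $\psi\colon\mathcal{P}(\mathbb{R}^d)\times\hat{\mathscr{B}}(\mathbb{R}^d,\mathbb{R}^d)\to\mathbb{R}$ be such that for all $C,D\in\mathcal{P}(\mathbb{R}^d)$, $\mathcal{M}\in\hat{\mathscr{B}}(\mathbb{R}^d,\mathbb{R}^d)$, $Q\in O(d)$: (0) $\psi(C,\cdot)$ is a biconic measure; (1) $\psi(C,\mathcal{M})=\psi(C,\mathcal{M}\cap \mathrm{BL}(C))$; (2) $\psi(Q C,Q \mathcal{M})=\psi(C,\mathcal{M})$; (3) $\psi(C,\mathcal{M})=\psi(D,\mathcal{M})$ if $\mathrm{BL}(C)\cap \mathcal{M}=\mathrm{BL}(D)\cap \mathcal{M}$. Then $\psi$ is a linear combination of $\hat\Delta$ and $\Theta_0,\ldots,\Theta_d$. In this case $$\psi = \psi\big(\mathbb{R}^d,\{0\} \big)\;\hat\Delta + \sum_{k=0}^d \psi\big(L^{(k)},\mathbb{R}^{d+d}_*\big)\;\Theta_k ,$$ where $L^{(k)}\subseteq\mathbb{R}^d$ denotes a $k$-dimensional linear subspace.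
   Context: A polyhedral cone in $\mathbb{R}^d$ is a set of the form $\{x\in\mathbb{R}^d : Ax\le 0\}$ for some real matrix $A$ with $d$ columns; $\mathcal{P}(\mathbb{R}^d)$ is the set of polyhedral cones in $\mathbb{R}^d$. The polar cone is $C^\circ=\{z: \langle x,z\rangle\le 0 \text{ for all } x\in C\}$. A face of $C$ is a subset $\{x\in C: \langle x,z\rangle=0\}$ with $z\in C^\circ$. $\mathcal{L}_k(C)$ is the finite set of linear spans of faces of $C$ whose span has dimension $k$. The $k$-skeleton is $S_k(C)=\bigcup_{L\in\mathcal{L}_k(C)}\mathrm{int}_L(C\cap L)$, where $\mathrm{int}_L$ is the interior relative to $L$. $\Pi_C:\mathbb{R}^d\to C$ is the orthogonal (nearest point) projection. Write $\mathbb{R}^{d+d}=\mathbb{R}^d\times\mathbb{R}^d$ and $\mathbb{R}^{d+d}_*=\mathbb{R}^{d+d}\setminus\{0\}$; $\{0\}$ as a biconic set is $\{(0,0)\}$. The biconic $\sigma$-algebra $\hat{\mathscr{B}}(\mathbb{R}^d,\mathbb{R}^d)$ consists of the Borel sets $\mathcal{M}\subseteq\mathbb{R}^{d+d}$ with $\{(\lambda x,\lambda' x'):(x,x')\in\mathcal{M}\}=\mathcal{M}$ for all $\lambda,\lambda'>0$. A biconic measure is a $\sigma$-additive real-valued function on $\hat{\mathscr{B}}(\mathbb{R}^d,\mathbb{R}^d)$. For $Q\in O(d)$, $Q\mathcal{M}=\{(Qx,Qx'):(x,x')\in\mathcal{M}\}$. The biconic lift of $C$ is $\mathrm{BL}(C)=\{(x,z)\in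 C\times C^\circ:\langle x,z\rangle=0\}$. $\hat\Delta$ is the Dirac measure at $(0,0)$, regarded as a function of $(C,\mathcal{M})$ independent of $C$. The support measures are $\Theta_k(C,\mathcal{M})=\mathbb{P}\{\Pi_C(g)\in S_k(C)\text{ and }(\Pi_C(g),\Pi_{C^\circ}(g))\in\mathcal{M}\}$, with $g\in\mathbb{R}^d$ a standard Gaussian vector, $0\le k\le d$. *)

theory Defs
  imports "HOL-Analysis.Analysis" "HOL-Probability.Probability"
begin

(* The sequence a 0, ..., a (m - 1) lists the rows of the matrix A in the description A x \<le> 0. *)
definition polyhedral_cones :: "(real^'n) set set" where
  "polyhedral_cones = {C. \<exists>(m::nat) (a :: nat \<Rightarrow> real^'n). C = {x. \<forall>i<m. a i \<bullet> x \<le> 0}}"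

definition polar_cone :: "(real^'n) set \<Rightarrow> (real^'n) set" where
  "polar_cone C = {z. \<forall>x\<in>C. x \<bullet> z \<le> 0}"

(* Not the library's face_of: here faces are exposed by an element of the polar cone,
   so they are never empty for a cone C. *)
definition cone_faces :: "(real^'n) set \<Rightarrow> (real^'n) set set" where
  "cone_faces C = {{x \<in> C. x \<bullet> z = 0} | z. z \<in> polar_cone C}"

definition face_spans :: "nat \<Rightarrow> (real^'n) set \<Rightarrow> (real^'n) set set" where
  "face_spans k C = {span F | F. F \<in> cone_faces C \<and> dim (span F) = k}"

definition cone_skeleton :: "nat \<Rightarrow> (real^'n) set \<Rightarrow> (real^'n) set" where
  "cone_skeleton k C = (\<Union>L\<in>face_spans k C. top_of_set L interior_of (C \<inter> L))"

definition biconic_sets :: "((real^'n) \<times> (real^'n)) set set" where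
  "biconic_sets = {M \<in> sets borel.
     \<forall>s>0. \<forall>t>0. (\<lambda>(x, y). (s *\<^sub>R x, t *\<^sub>R y)) ` M = M}"

(* A real-valued, hence finite and possibly signed, measure: the library's measure type and
   countably_additive only cover values in [0, \<infinity>].
   The condition on the empty set follows by taking A to be constantly empty. *)
definition biconic_measure :: "(((real^'n) \<times> (real^'n)) set \<Rightarrow> real) \<Rightarrow> bool" where
  "biconic_measure \<mu> \<longleftrightarrow>
     (\<forall>A :: nat \<Rightarrow> ((real^'n) \<times> (real^'n)) set.
        range A \<subseteq> biconic_sets \<longrightarrow> disjoint_family A \<longrightarrow>
        (\<lambda>i. \<mu> (A i)) sums \<mu> (\<Union>i. A i))"

definition biconic_lift :: "(real^'n) set \<Rightarrow> ((real^'n) \<times> (real^'n)) set" where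
  "biconic_lift C = {(x, z). x \<in> C \<and> z \<in> polar_cone C \<and> x \<bullet> z = 0}"

definition dirac_zero :: "((real^'n) \<times> (real^'n)) set \<Rightarrow> real" where
  "dirac_zero M = indicator M (0, 0)"

(* The law of a vector with independent standard normal coordinates. *)
definition std_gaussian :: "(real^'n) measure" where
  "std_gaussian = density lborel (\<lambda>x. \<Prod>i\<in>UNIV. ennreal (std_normal_density (x $ i)))"

definition support_measure ::
  "nat \<Rightarrow> (real^'n) set \<Rightarrow> ((real^'n) \<times> (real^'n)) set \<Rightarrow> real" where
  "support_measure k C M =
     measure std_gaussian {g. closest_point C g \<in> cone_skeleton k C \<and>
                              (closest_point C g, closest_point (polar_cone C) g) \<in> M}"

end

theory Submission
  imports Defs
begin

text \<open>
  The biconic lift of a polyhedral cone \<open>C\<close> is a disjoint union of finitely many cells, one for each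
  span \<open>L\<close> of a face: the relative interior of \<open>C \<inter> L\<close> times the part of the polar cone that is
  orthogonal to \<open>L\<close>. Such a cell also lies in \<open>L \<times> L\<^sup>\<bottom>\<close>, which is the biconic lift of \<open>L\<close>. Hence
  locality replaces \<open>\<psi> C\<close> by \<open>\<psi> L\<close> on each cell, and it remains to determine \<open>\<psi> L\<close> for linear
  subspaces \<open>L\<close>.

  There \<open>\<psi> L\<close> is invariant under all orthogonal transformations that map \<open>L\<close> onto itself. Up to
  positive scaling of both components, \<open>L \<times> L\<^sup>\<bottom>\<close> consists of at most four orbits of these
  transformations. On the orbit of the origin locality yields the coefficient \<open>\<psi> UNIV {(0, 0)}\<close>. On the
  generic orbit, where a component vanishes only if its subspace is trivial, an invariant signed
  measure is determined by its total mass (\<open>transitive_invariant_signed_measure_unique\<close>), so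
  \<open>\<psi> L\<close> is a multiple of the law of the two orthogonal projections of a Gaussian vector
  (\<open>generic_part_formula\<close>). On a remaining orbit one component is zero although its subspace is not
  trivial; there locality compares \<open>L\<close> with the cone \<open>{0}\<close> or with the whole space, whose generic law
  gives no mass to a proper subspace (\<open>degenerate_parts_vanish\<close>). Together these facts give
  \<open>subspace_formula\<close>. Its second coefficient depends only on the dimension of \<open>L\<close>, because subspaces
  of equal dimension are related by an orthogonal transformation.

  Finally, on a cell of \<open>C\<close> the two Gaussian projections for \<open>L\<close> and the two metric projections for
  \<open>C\<close> agree, by uniqueness of the Moreau decomposition. So adding the Gaussian terms over the cells of
  dimension \<open>k\<close> gives the support measure of order \<open>k\<close> (\<open>support_measure_eq_sum_face_cells\<close>).

  Uniqueness of invariant signed measures is reduced to positive measures by splitting a signed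
  measure into the difference of two upper variations, which inherit the invariance. For positive
  measures no Haar measure on the group is needed: a transitive group of isometries makes all balls of
  a given radius equally heavy, and two finite measures with this property are proportional, by
  counting pairs of nearby points in two ways.
\<close>

section \<open>Signed measures and their upper variation\<close>

definition signed_measure_on :: "'a measure \<Rightarrow> ('a set \<Rightarrow> real) \<Rightarrow> bool" where
  "signed_measure_on M \<nu> \<longleftrightarrow>
     (\<forall>A :: nat \<Rightarrow> 'a set. range A \<subseteq> sets M \<longrightarrow> disjoint_family A \<longrightarrow>
        (\<lambda>i. \<nu> (A i)) sums \<nu> (\<Union>i. A i))"

lemma signed_measure_onD:
  assumes "signed_measure_on M \<nu>" "\<And>i::nat. A i \<in> sets M" "disjoint_family A"
  shows "(\<lambda>i. \<nu> (A i)) sums \<nu> (\<Union>i. A i)"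
proof -
  have "range A \<subseteq> sets M" using assms(2) by auto
  then show ?thesis using assms(1,3) unfolding signed_measure_on_def by blast
qed

lemma signed_measure_on_empty:
  assumes "signed_measure_on M \<nu>"
  shows "\<nu> {} = 0"
proof -
  have "(\<lambda>i::nat. \<nu> {}) sums \<nu> (\<Union>i::nat. {})"
    by (rule signed_measure_onD[OF assms]) (auto simp: disjoint_family_on_def)
  then have "summable (\<lambda>i::nat. \<nu> {})" by (rule sums_summable)
  then show ?thesis by (simp add: summable_const_iff)
qed

lemma signed_measure_on_Un:
  assumes \<nu>: "signed_measure_on M \<nu>" and AB: "A \<in> sets M" "B \<in> sets M" "A \<inter> B = {}"
  shows "\<nu> (A \<union> B) = \<nu> A + \<nu> B"
proof -
  have "binaryset A B i \<in> sets M" for i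
    using AB by (simp add: binaryset_def)
  moreover have "disjoint_family (binaryset A B)"
    using AB by (auto simp: disjoint_family_on_def binaryset_def)
  ultimately have "(\<lambda>i. \<nu> (binaryset A B i)) sums \<nu> (\<Union>i. binaryset A B i)"
    by (rule signed_measure_onD[OF \<nu>])
  moreover have "(\<lambda>i. \<nu> (binaryset A B i)) sums (\<nu> A + \<nu> B)"
    by (rule binaryset_sums) (rule signed_measure_on_empty[OF \<nu>])
  ultimately show ?thesis
    by (simp only: UN_binaryset_eq) (rule sums_unique2)
qed

lemma signed_measure_on_Diff:
  assumes "signed_measure_on M \<nu>" "A \<in> sets M" "B \<in> sets M" "B \<subseteq> A"
  shows "\<nu> (A - B) = \<nu> A - \<nu> B"
  using signed_measure_on_Un[of M \<nu> B "A - B"] assms by (auto simp: Un_absorb1)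

lemma signed_measure_on_uminus:
  "signed_measure_on M \<nu> \<Longrightarrow> signed_measure_on M (\<lambda>A. - \<nu> A)"
  unfolding signed_measure_on_def by (auto intro!: sums_minus)

text \<open>
  This is the positive part in the Jordan decomposition. Defining it as a supremum over subsets, with
  values in the extended half-line, makes countable additivity and invariance direct and leaves
  finiteness to be shown separately.
\<close>

definition upper_variation :: "'a measure \<Rightarrow> ('a set \<Rightarrow> real) \<Rightarrow> 'a set \<Rightarrow> ennreal" where
  "upper_variation M \<nu> A = (SUP B\<in>{B \<in> sets M. B \<subseteq> A}. ennreal (\<nu> B))"

lemma upper_variation_upper:
  "B \<in> sets M \<Longrightarrow> B \<subseteq> A \<Longrightarrow> ennreal (\<nu> B) \<le> upper_variation M \<nu> A"
  unfolding upper_variation_def by (rule SUP_upper) auto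

lemma upper_variation_mono: "A \<subseteq> B \<Longrightarrow> upper_variation M \<nu> A \<le> upper_variation M \<nu> B"
  unfolding upper_variation_def by (rule SUP_subset_mono) auto

lemma upper_variation_Un:
  assumes \<nu>: "signed_measure_on M \<nu>" and AB: "A \<inter> B = {}"
  shows "upper_variation M \<nu> A + upper_variation M \<nu> B \<le> upper_variation M \<nu> (A \<union> B)"
proof -
  have pair: "ennreal (\<nu> C) + ennreal (\<nu> D) \<le> upper_variation M \<nu> (A \<union> B)"
    if C: "C \<in> sets M" "C \<subseteq> A" and D: "D \<in> sets M" "D \<subseteq> B" for C D
  proof -
    have "C \<inter> D = {}" using that AB by blast
    then have CD: "\<nu> (C \<union> D) = \<nu> C + \<nu> D"
      using signed_measure_on_Un[OF \<nu>] that by blast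
    have up: "ennreal (\<nu> (C \<union> D)) \<le> upper_variation M \<nu> (A \<union> B)"
      "ennreal (\<nu> C) \<le> upper_variation M \<nu> (A \<union> B)" "ennreal (\<nu> D) \<le> upper_variation M \<nu> (A \<union> B)"
      using that by (auto intro!: upper_variation_upper)
    consider "\<nu> C \<ge> 0" "\<nu> D \<ge> 0" | "\<nu> C \<le> 0" | "\<nu> D \<le> 0" by linarith
    then show ?thesis
      by cases (use up CD in \<open>auto simp: ennreal_plus ennreal_neg\<close>)
  qed
  have "upper_variation M \<nu> A + upper_variation M \<nu> B
      = (SUP C\<in>{C \<in> sets M. C \<subseteq> A}. ennreal (\<nu> C) + upper_variation M \<nu> B)"
    unfolding upper_variation_def[of M \<nu> A] by (rule ennreal_SUP_add_left[symmetric]) auto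
  also have "\<dots> \<le> upper_variation M \<nu> (A \<union> B)"
  proof (rule SUP_least)
    fix C assume C: "C \<in> {C \<in> sets M. C \<subseteq> A}"
    have "ennreal (\<nu> C) + upper_variation M \<nu> B
        = (SUP D\<in>{D \<in> sets M. D \<subseteq> B}. ennreal (\<nu> C) + ennreal (\<nu> D))"
      unfolding upper_variation_def[of M \<nu> B] by (rule ennreal_SUP_add_right) auto
    also have "\<dots> \<le> upper_variation M \<nu> (A \<union> B)"
      using C by (intro SUP_least pair) auto
    finally show "ennreal (\<nu> C) + upper_variation M \<nu> B \<le> upper_variation M \<nu> (A \<union> B)" .
  qed
  finally show ?thesis .
qed

lemma ennreal_sum_le: "ennreal (\<Sum>i\<in>I. f i) \<le> (\<Sum>i\<in>I. ennreal (f i))"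
proof (induction I rule: infinite_finite_induct)
  case (insert i I)
  have "ennreal (f i + sum f I) \<le> ennreal (f i) + ennreal (sum f I)"
    by (cases "f i \<ge> 0"; cases "sum f I \<ge> 0")
       (auto simp: ennreal_neg ennreal_leI)
  also have "\<dots> \<le> ennreal (f i) + (\<Sum>i\<in>I. ennreal (f i))"
    using insert.IH by (rule add_left_mono)
  finally show ?case using insert.hyps by simp
qed auto

definition upper_variation_measure :: "'a measure \<Rightarrow> ('a set \<Rightarrow> real) \<Rightarrow> 'a measure" where
  "upper_variation_measure M \<nu> = measure_of (space M) (sets M) (upper_variation M \<nu>)"

lemma sets_upper_variation_measure [simp, measurable_cong]:
  "sets (upper_variation_measure M \<nu>) = sets M"
  by (simp add: upper_variation_measure_def)

lemma space_upper_variation_measure [simp]: "space (upper_variation_measure M \<nu>) = space M"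
  by (simp add: upper_variation_measure_def)

lemma countably_additive_upper_variation:
  assumes \<nu>: "signed_measure_on M \<nu>"
  shows "countably_additive (sets M) (upper_variation M \<nu>)"
proof (rule countably_additiveI)
  fix A :: "nat \<Rightarrow> 'a set"
  assume A: "range A \<subseteq> sets M" "disjoint_family A"
  have partial: "(\<Sum>i<n. upper_variation M \<nu> (A i)) \<le> upper_variation M \<nu> (\<Union>i<n. A i)" for n
  proof (induction n)
    case (Suc n)
    have "A i \<inter> A n = {}" if "i < n" for i
      using disjoint_family_onD[OF A(2), of i n] that by simp
    then have "(\<Union>i<n. A i) \<inter> A n = {}" by auto
    then have "upper_variation M \<nu> (\<Union>i<n. A i) + upper_variation M \<nu> (A n)
        \<le> upper_variation M \<nu> ((\<Union>i<n. A i) \<union> A n)"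
      by (rule upper_variation_Un[OF \<nu>])
    moreover have "(\<Union>i<n. A i) \<union> A n = (\<Union>i<Suc n. A i)"
      by (auto simp: less_Suc_eq)
    ultimately show ?case
      unfolding sum.lessThan_Suc
      using order_trans[OF add_right_mono[OF Suc.IH, of "upper_variation M \<nu> (A n)"]] by simp
  qed simp
  show "(\<Sum>i. upper_variation M \<nu> (A i)) = upper_variation M \<nu> (\<Union>i. A i)"
  proof (rule antisym)
    show "(\<Sum>i. upper_variation M \<nu> (A i)) \<le> upper_variation M \<nu> (\<Union>i. A i)"
      unfolding suminf_eq_SUP
      by (rule SUP_least, rule order_trans[OF partial], rule upper_variation_mono) auto
    show "upper_variation M \<nu> (\<Union>i. A i) \<le> (\<Sum>i. upper_variation M \<nu> (A i))"
      unfolding upper_variation_def[of M \<nu> "\<Union>i. A i"]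
    proof (rule SUP_least)
      fix B assume B: "B \<in> {B \<in> sets M. B \<subseteq> (\<Union>i. A i)}"
      have "(\<lambda>i. \<nu> (B \<inter> A i)) sums \<nu> (\<Union>i. B \<inter> A i)"
        using \<nu>[unfolded signed_measure_on_def, rule_format, of "\<lambda>i. B \<inter> A i"] A B
        by (fastforce simp: disjoint_family_on_def)
      moreover have "(\<Union>i. B \<inter> A i) = B" using B by auto
      ultimately have "(\<lambda>n. \<Sum>i<n. \<nu> (B \<inter> A i)) \<longlonglongrightarrow> \<nu> B"
        by (simp add: sums_def)
      then have lim: "(\<lambda>n. ennreal (\<Sum>i<n. \<nu> (B \<inter> A i))) \<longlonglongrightarrow> ennreal (\<nu> B)"
        by (rule tendsto_ennrealI)
      have "ennreal (\<Sum>i<n. \<nu> (B \<inter> A i)) \<le> (\<Sum>i. upper_variation M \<nu> (A i))" for n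
      proof -
        have "ennreal (\<Sum>i<n. \<nu> (B \<inter> A i)) \<le> (\<Sum>i<n. ennreal (\<nu> (B \<inter> A i)))"
          by (rule ennreal_sum_le)
        also have "\<dots> \<le> (\<Sum>i<n. upper_variation M \<nu> (A i))"
          using A B by (intro sum_mono upper_variation_upper) auto
        also have "\<dots> \<le> (\<Sum>i. upper_variation M \<nu> (A i))"
          by (rule sum_le_suminf) auto
        finally show ?thesis .
      qed
      then show "ennreal (\<nu> B) \<le> (\<Sum>i. upper_variation M \<nu> (A i))"
        by (intro LIMSEQ_le_const2[OF lim]) auto
    qed
  qed
qed

lemma emeasure_upper_variation_measure:
  assumes \<nu>: "signed_measure_on M \<nu>" and A: "A \<in> sets M"
  shows "emeasure (upper_variation_measure M \<nu>) A = upper_variation M \<nu> A"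
  unfolding upper_variation_measure_def
proof (rule emeasure_measure_of_sigma)
  show "sigma_algebra (space M) (sets M)" by (rule sets.sigma_algebra_axioms)
  have "upper_variation M \<nu> {} = 0"
    by (simp add: upper_variation_def subset_empty cong: conj_cong)
       (auto simp: signed_measure_on_empty[OF \<nu>] intro!: antisym SUP_least)
  then show "positive (sets M) (upper_variation M \<nu>)" by (simp add: positive_def)
qed (use assms countably_additive_upper_variation in auto)

text \<open>
  If the variation of \<open>A\<close> is infinite, then \<open>A\<close> has a subset whose value exceeds
  \<open>\<bar>\<nu> A\<bar> + 1\<close>. This subset and its complement in \<open>A\<close> both have value at least 1 in modulus, and
  by additivity one of the two still has infinite variation.
\<close>

lemma upper_variation_halving:
  assumes \<nu>: "signed_measure_on M \<nu>" and A: "A \<in> sets M" and inf: "upper_variation M \<nu> A = \<infinity>"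
  shows "\<exists>B\<in>sets M. B \<subseteq> A \<and> upper_variation M \<nu> B = \<infinity> \<and> 1 \<le> \<bar>\<nu> (A - B)\<bar>"
proof -
  let ?u = "upper_variation M \<nu>"
  have "ennreal (\<bar>\<nu> A\<bar> + 1) < (SUP B\<in>{B \<in> sets M. B \<subseteq> A}. ennreal (\<nu> B))"
    unfolding upper_variation_def[symmetric] inf infinity_ennreal_def by (rule ennreal_less_top)
  then obtain B where B: "B \<in> sets M" "B \<subseteq> A" and "ennreal (\<bar>\<nu> A\<bar> + 1) < ennreal (\<nu> B)"
    unfolding less_SUP_iff by auto
  then have big: "\<bar>\<nu> A\<bar> + 1 < \<nu> B"
    by (metis abs_ge_zero add_nonneg_nonneg ennreal_less_iff zero_le_one)
  have diff: "\<nu> (A - B) = \<nu> A - \<nu> B"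
    using signed_measure_on_Diff[OF \<nu>] A B by auto
  have "?u A = ?u B + ?u (A - B)"
    using plus_emeasure[of B "upper_variation_measure M \<nu>" "A - B"] A B
    by (simp add: emeasure_upper_variation_measure[OF \<nu>] Un_absorb1)
  then have "?u B = \<infinity> \<or> ?u (A - B) = \<infinity>"
    using inf by (metis ennreal_add_eq_top infinity_ennreal_def)
  then show ?thesis
  proof
    assume "?u B = \<infinity>"
    then show ?thesis using B big diff by (intro bexI[of _ B]) auto
  next
    assume "?u (A - B) = \<infinity>"
    moreover have "A - (A - B) = B" using B by auto
    ultimately show ?thesis using A B big by (intro bexI[of _ "A - B"]) auto
  qed
qed

text \<open>
  Otherwise the previous step can be iterated. It removes successively disjoint sets of value at least
  1 in modulus, whose values would have to form a convergent series.
\<close>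

lemma finite_measure_upper_variation_measure:
  assumes \<nu>: "signed_measure_on M \<nu>"
  shows "finite_measure (upper_variation_measure M \<nu>)"
proof (rule finite_measureI, rule notI)
  let ?P = "\<lambda>A. A \<in> sets M \<and> upper_variation M \<nu> A = \<infinity>"
  assume "emeasure (upper_variation_measure M \<nu>) (space (upper_variation_measure M \<nu>)) = \<infinity>"
  then have "?P (space M)" by (simp add: emeasure_upper_variation_measure[OF \<nu>])
  moreover have "\<exists>B. ?P B \<and> B \<subseteq> A \<and> 1 \<le> \<bar>\<nu> (A - B)\<bar>" if "?P A" for A
    using upper_variation_halving[OF \<nu>, of A] that by auto
  ultimately obtain f :: "nat \<Rightarrow> 'a set"
    where f: "\<And>n. ?P (f n)" "\<And>n. f (Suc n) \<subseteq> f n \<and> 1 \<le> \<bar>\<nu> (f n - f (Suc n))\<bar>"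
    using dependent_nat_choice[of "\<lambda>_. ?P" "\<lambda>_ A B. B \<subseteq> A \<and> 1 \<le> \<bar>\<nu> (A - B)\<bar>"] by metis
  have "decseq f" using f(2) by (auto intro: decseq_SucI)
  then have dec: "f n \<subseteq> f (Suc m)" if "m < n" for m n
    using that by (auto simp: decseq_def Suc_le_eq)
  have "disjoint_family (\<lambda>n. f n - f (Suc n))"
    unfolding disjoint_family_on_def
  proof (intro ballI impI)
    fix m n :: nat assume "m \<noteq> n"
    then show "(f m - f (Suc m)) \<inter> (f n - f (Suc n)) = {}"
      using dec[of m n] dec[of n m] by (cases "m < n") auto
  qed
  then have "(\<lambda>n. \<nu> (f n - f (Suc n))) sums \<nu> (\<Union>n. f n - f (Suc n))"
    by (intro signed_measure_onD[OF \<nu>]) (use f(1) in auto)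
  then have "(\<lambda>n. \<nu> (f n - f (Suc n))) \<longlonglongrightarrow> 0"
    by (intro summable_LIMSEQ_zero sums_summable)
  then have "\<forall>\<^sub>F n in sequentially. dist (\<nu> (f n - f (Suc n))) 0 < 1"
    by (rule tendstoD) simp
  then obtain n where "\<bar>\<nu> (f n - f (Suc n))\<bar> < 1"
    by (auto simp: eventually_sequentially)
  then show False using f(2)[of n] by simp
qed

text \<open>
  Every subset \<open>B\<close> of \<open>A\<close> satisfies \<open>\<nu> B = \<nu> A + (- \<nu> (A - B))\<close>. Taking suprema bounds the upper
  variation of \<open>\<nu>\<close> by \<open>\<nu> A\<close> plus that of \<open>- \<nu>\<close>, and exchanging \<open>\<nu>\<close> with \<open>- \<nu>\<close> gives the reverse bound.
\<close>

lemma upper_variation_decomposition: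
  assumes \<nu>: "signed_measure_on M \<nu>" and A: "A \<in> sets M"
  shows "\<nu> A = measure (upper_variation_measure M \<nu>) A
             - measure (upper_variation_measure M (\<lambda>A. - \<nu> A)) A"
proof -
  have le: "measure (upper_variation_measure M \<mu>) A
      \<le> \<mu> A + measure (upper_variation_measure M (\<lambda>A. - \<mu> A)) A"
    if \<mu>: "signed_measure_on M \<mu>" for \<mu>
  proof -
    let ?N = "upper_variation_measure M (\<lambda>A. - \<mu> A)"
    note \<mu>' = signed_measure_on_uminus[OF \<mu>]
    interpret N: finite_measure ?N by (rule finite_measure_upper_variation_measure[OF \<mu>'])
    interpret P: finite_measure "upper_variation_measure M \<mu>"
      by (rule finite_measure_upper_variation_measure[OF \<mu>])
    have sub: "\<mu> B \<le> \<mu> A + measure ?N A" if B: "B \<in> sets M" "B \<subseteq> A" for B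
    proof -
      have "ennreal (- \<mu> (A - B)) \<le> ennreal (measure ?N A)"
        unfolding N.emeasure_eq_measure[symmetric] emeasure_upper_variation_measure[OF \<mu>' A]
        by (rule upper_variation_upper[where \<nu> = "\<lambda>A. - \<mu> A"]) (use A B in auto)
      then show ?thesis
        using signed_measure_on_Diff[OF \<mu> A B] by (simp add: ennreal_le_iff)
    qed
    have nonneg: "0 \<le> \<mu> A + measure ?N A"
      using sub[of "{}"] signed_measure_on_empty[OF \<mu>] by simp
    have "upper_variation M \<mu> A \<le> ennreal (\<mu> A + measure ?N A)"
      unfolding upper_variation_def using sub by (intro SUP_least ennreal_leI) auto
    then show ?thesis
      unfolding emeasure_upper_variation_measure[OF \<mu> A, symmetric] P.emeasure_eq_measure
      using nonneg by (simp add: ennreal_le_iff)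
  qed
  show ?thesis
    using le[OF \<nu>] le[OF signed_measure_on_uminus[OF \<nu>]] by simp
qed

lemma upper_variation_image_invariant:
  assumes f: "bij f" "\<And>A. A \<in> sets M \<Longrightarrow> f ` A \<in> sets M" "\<And>A. A \<in> sets M \<Longrightarrow> f -` A \<in> sets M"
    and inv: "\<And>A. A \<in> sets M \<Longrightarrow> \<nu> (f ` A) = \<nu> A"
  shows "upper_variation M \<nu> (f ` A) = upper_variation M \<nu> A"
  unfolding upper_variation_def
proof (rule SUP_eq)
  fix B assume B: "B \<in> {B \<in> sets M. B \<subseteq> f ` A}"
  have "f ` (f -` B) = B" using f(1) by (simp add: bij_is_surj surj_image_vimage_eq)
  moreover have "f -` B \<subseteq> A"
    using B f(1) vimage_mono[of B "f ` A" f] by (simp add: bij_is_inj inj_vimage_image_eq)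
  ultimately show "\<exists>C\<in>{B \<in> sets M. B \<subseteq> A}. ennreal (\<nu> B) \<le> ennreal (\<nu> C)"
    using B f(3) inv[of "f -` B"] by (intro bexI[of _ "f -` B"]) auto
next
  fix B assume "B \<in> {B \<in> sets M. B \<subseteq> A}"
  then show "\<exists>C\<in>{B \<in> sets M. B \<subseteq> f ` A}. ennreal (\<nu> B) \<le> ennreal (\<nu> C)"
    using f(2) inv by (intro bexI[of _ "f ` B"]) auto
qed

section \<open>Uniformly distributed measures on a metric space\<close>

definition uniformly_distributed_on :: "'a::metric_space set \<Rightarrow> 'a measure \<Rightarrow> bool" where
  "uniformly_distributed_on S \<mu> \<longleftrightarrow>
     finite_measure \<mu> \<and> sets \<mu> = sets borel \<and> (AE x in \<mu>. x \<in> S) \<and>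
     (\<forall>x\<in>S. \<forall>y\<in>S. \<forall>r. measure \<mu> (ball x r) = measure \<mu> (ball y r))"

text \<open>
  The pairs \<open>(x, y)\<close> with \<open>x \<in> A\<close> at distance less than \<open>r\<close> are measured by \<open>\<mu> \<Otimes> \<gamma>\<close> in the two
  orders of integration. Sections at fixed \<open>x\<close> are balls, and sections at fixed \<open>y\<close> are contained in
  balls and empty unless \<open>y \<in> B\<close>.
\<close>

lemma uniformly_distributed_ball_double_count:
  fixes \<mu> \<gamma> :: "'a::{metric_space, second_countable_topology} measure"
  assumes \<mu>: "uniformly_distributed_on S \<mu>" and \<gamma>: "uniformly_distributed_on S \<gamma>"
    and s: "s \<in> S" and A: "A \<in> sets borel" and B: "B \<in> sets borel"
    and AB: "\<And>x. x \<in> A \<Longrightarrow> ball x r \<subseteq> B"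
  shows "measure \<mu> A * measure \<gamma> (ball s r) \<le> measure \<gamma> B * measure \<mu> (ball s r)"
proof -
  interpret M: finite_measure \<mu> using \<mu> by (simp add: uniformly_distributed_on_def)
  interpret G: finite_measure \<gamma> using \<gamma> by (simp add: uniformly_distributed_on_def)
  interpret pair_sigma_finite \<mu> \<gamma> ..
  have [measurable_cong, simp]: "sets \<mu> = sets borel" "sets \<gamma> = sets borel"
    using \<mu> \<gamma> by (auto simp: uniformly_distributed_on_def)
  have [simp]: "space \<mu> = UNIV" "space \<gamma> = UNIV"
    by (simp_all add: sets_eq_imp_space_eq[of _ borel])
  have ball: "emeasure \<mu> (ball x r) = measure \<mu> (ball s r)"
    "emeasure \<gamma> (ball x r) = measure \<gamma> (ball s r)" if "x \<in> S" for x
  proof -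
    have "measure \<mu> (ball x r) = measure \<mu> (ball s r)" "measure \<gamma> (ball x r) = measure \<gamma> (ball s r)"
      using \<mu> \<gamma> s that unfolding uniformly_distributed_on_def by blast+
    then show "emeasure \<mu> (ball x r) = measure \<mu> (ball s r)"
      "emeasure \<gamma> (ball x r) = measure \<gamma> (ball s r)"
      by (simp_all only: M.emeasure_eq_measure G.emeasure_eq_measure)
  qed
  define E where "E = {p :: 'a \<times> 'a. fst p \<in> A \<and> dist (fst p) (snd p) < r}"
  have E: "E \<in> sets (\<mu> \<Otimes>\<^sub>M \<gamma>)"
  proof -
    have "sets (\<mu> \<Otimes>\<^sub>M \<gamma>) = sets (borel :: ('a \<times> 'a) measure)"
      unfolding borel_prod[symmetric] by (rule sets_pair_measure_cong) simp_all
    moreover have "open {p :: 'a \<times> 'a. dist (fst p) (snd p) < r}"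
      by (intro open_Collect_less continuous_intros)
    moreover have "A \<times> UNIV \<in> sets (borel :: ('a \<times> 'a) measure)"
      unfolding borel_prod[symmetric] using A by (intro pair_measureI) auto
    moreover have "E = (A \<times> UNIV) \<inter> {p. dist (fst p) (snd p) < r}"
      by (auto simp: E_def)
    ultimately show ?thesis by (simp only: sets.Int borel_open)
  qed
  have "ennreal (measure \<mu> A * measure \<gamma> (ball s r)) = (\<integral>\<^sup>+x. ennreal (measure \<gamma> (ball s r)) * indicator A x \<partial>\<mu>)"
    unfolding mult.commute[of "measure \<mu> A"]
    by (subst nn_integral_cmult_indicator) (simp_all add: A M.emeasure_eq_measure ennreal_mult)
  also have "\<dots> = (\<integral>\<^sup>+x. emeasure \<gamma> (Pair x -` E) \<partial>\<mu>)"
  proof (rule nn_integral_cong_AE)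
    have "AE x in \<mu>. x \<in> S" using \<mu> by (simp add: uniformly_distributed_on_def)
    then show "AE x in \<mu>. ennreal (measure \<gamma> (ball s r)) * indicator A x = emeasure \<gamma> (Pair x -` E)"
    proof eventually_elim
      case (elim x)
      have "Pair x -` E = (if x \<in> A then ball x r else {})" by (auto simp: E_def)
      then show ?case using ball[OF elim] by simp
    qed
  qed
  also have "\<dots> = (\<integral>\<^sup>+y. emeasure \<mu> ((\<lambda>x. (x, y)) -` E) \<partial>\<gamma>)"
    using G.emeasure_pair_measure_alt[OF E] emeasure_pair_measure_alt2[OF E] by simp
  also have "\<dots> \<le> (\<integral>\<^sup>+y. ennreal (measure \<mu> (ball s r)) * indicator B y \<partial>\<gamma>)"
  proof (rule nn_integral_mono_AE)
    have "AE y in \<gamma>. y \<in> S" using \<gamma> by (simp add: uniformly_distributed_on_def)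
    then show "AE y in \<gamma>. emeasure \<mu> ((\<lambda>x. (x, y)) -` E) \<le> ennreal (measure \<mu> (ball s r)) * indicator B y"
    proof eventually_elim
      case (elim y)
      show ?case
      proof (cases "y \<in> B")
        case True
        have "emeasure \<mu> ((\<lambda>x. (x, y)) -` E) \<le> emeasure \<mu> (ball y r)"
          by (rule emeasure_mono) (auto simp: E_def dist_commute)
        then show ?thesis using True ball[OF elim] by simp
      next
        case False
        then have "(\<lambda>x. (x, y)) -` E = {}" using AB by (fastforce simp: E_def)
        then show ?thesis by simp
      qed
    qed
  qed
  also have "\<dots> = ennreal (measure \<gamma> B * measure \<mu> (ball s r))"
    unfolding mult.commute[of "measure \<gamma> B"]
    by (subst nn_integral_cmult_indicator) (simp_all add: B G.emeasure_eq_measure ennreal_mult)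
  finally show ?thesis by (simp add: ennreal_le_iff)
qed

text \<open>
  If one ball centred in \<open>S\<close> were null, all balls of its radius centred in \<open>S\<close> would be null. Countably
  many balls of half the radius cover the space, and each of them is null: it misses \<open>S\<close> or lies in such a null ball.
\<close>

lemma uniformly_distributed_ball_pos:
  fixes \<gamma> :: "'a::{metric_space, second_countable_topology} measure"
  assumes \<gamma>: "uniformly_distributed_on S \<gamma>" and s: "s \<in> S" and r: "r > 0"
    and pos: "measure \<gamma> UNIV > 0"
  shows "measure \<gamma> (ball s r) > 0"
proof (rule ccontr)
  interpret G: finite_measure \<gamma> using \<gamma> by (simp add: uniformly_distributed_on_def)
  have [measurable_cong, simp]: "sets \<gamma> = sets borel"
    using \<gamma> by (auto simp: uniformly_distributed_on_def)
  have [simp]: "space \<gamma> = UNIV" by (simp add: sets_eq_imp_space_eq[of _ borel])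
  assume "\<not> measure \<gamma> (ball s r) > 0"
  then have zero: "measure \<gamma> (ball s r) = 0" by (simp add: zero_less_measure_iff)
  have null: "ball x r \<in> null_sets \<gamma>" if "x \<in> S" for x
  proof -
    have "measure \<gamma> (ball x r) = measure \<gamma> (ball s r)"
      using \<gamma> s that unfolding uniformly_distributed_on_def by blast
    then show ?thesis using zero by (intro null_setsI) (simp_all add: G.emeasure_eq_measure)
  qed
  obtain D :: "'a set" where D: "countable D" "\<And>X. open X \<Longrightarrow> X \<noteq> {} \<Longrightarrow> \<exists>d\<in>D. d \<in> X"
    using countable_dense_exists by blast
  have "ball d (r/2) \<in> null_sets \<gamma>" for d
  proof (cases "ball d (r/2) \<inter> S = {}")
    case True
    have "AE x in \<gamma>. x \<in> S" using \<gamma> by (simp add: uniformly_distributed_on_def)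
    then have "AE x in \<gamma>. x \<notin> ball d (r/2)" by eventually_elim (use True in auto)
    then show ?thesis by (subst AE_iff_null_sets) auto
  next
    case False
    then obtain x where x: "x \<in> S" "dist d x < r/2" by auto
    have "ball d (r/2) \<subseteq> ball x r"
    proof
      fix y assume "y \<in> ball d (r/2)"
      then show "y \<in> ball x r"
        using x(2) dist_triangle[of x y d] by (simp add: dist_commute)
    qed
    then show ?thesis by (rule null_sets_subset[OF null[OF x(1)], rotated]) simp
  qed
  then have "(\<Union>d\<in>D. ball d (r/2)) \<in> null_sets \<gamma>" by (intro null_sets_UN' D(1))
  moreover have "(\<Union>d\<in>D. ball d (r/2)) = UNIV"
  proof (rule UNIV_eq_I[symmetric])
    fix x
    obtain d where "d \<in> D" "d \<in> ball x (r/2)" using D(2)[of "ball x (r/2)"] r by auto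
    then show "x \<in> (\<Union>d\<in>D. ball d (r/2))" by (auto simp: dist_commute)
  qed
  ultimately have "UNIV \<in> null_sets \<gamma>" by simp
  then have "emeasure \<gamma> UNIV = 0" by (rule null_setsD1)
  then show False using pos by (simp add: measure_def)
qed

text \<open>
  The set of points whose \<open>r\<close>-ball lies in \<open>U\<close> can be compared with \<open>U\<close> by double counting. The factor
  relating the masses of balls is the ratio of the total masses, by the case \<open>U = UNIV\<close>, so it does not
  depend on \<open>r\<close>. These sets exhaust \<open>U\<close> as \<open>r\<close> tends to 0.
\<close>

lemma uniformly_distributed_open_le:
  fixes \<mu> \<gamma> :: "'a::{metric_space, second_countable_topology} measure"
  assumes \<mu>: "uniformly_distributed_on S \<mu>" and \<gamma>: "uniformly_distributed_on S \<gamma>"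
    and s: "s \<in> S" and U: "open U"
  shows "measure \<mu> U * measure \<gamma> UNIV \<le> measure \<gamma> U * measure \<mu> UNIV"
proof (cases "measure \<gamma> UNIV > 0")
  case True
  interpret M: finite_measure \<mu> using \<mu> by (simp add: uniformly_distributed_on_def)
  have [measurable_cong, simp]: "sets \<mu> = sets borel"
    using \<mu> by (auto simp: uniformly_distributed_on_def)
  define A where "A n = {x. ball x (1 / real (Suc n)) \<subseteq> U}" for n
  have A_closed: "closed (A n)" for n
  proof -
    have "A n = - (\<Union>y\<in>-U. ball y (1 / real (Suc n)))"
      by (auto simp: A_def dist_commute)
    then show ?thesis by (simp add: closed_def open_UN)
  qed
  have A_le: "measure \<mu> (A n) * measure \<gamma> UNIV \<le> measure \<gamma> U * measure \<mu> UNIV" for n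
  proof -
    let ?r = "1 / real (Suc n)"
    let ?g = "measure \<gamma> (ball s ?r)" and ?m = "measure \<mu> (ball s ?r)"
    have pos: "?g > 0" by (rule uniformly_distributed_ball_pos[OF \<gamma> s _ True]) simp
    have total: "measure \<mu> UNIV * ?g = measure \<gamma> UNIV * ?m"
      using uniformly_distributed_ball_double_count[OF \<mu> \<gamma> s, of UNIV UNIV ?r]
        uniformly_distributed_ball_double_count[OF \<gamma> \<mu> s, of UNIV UNIV ?r] by simp
    have "measure \<mu> (A n) * ?g \<le> measure \<gamma> U * ?m"
      by (rule uniformly_distributed_ball_double_count[OF \<mu> \<gamma> s])
         (use U A_closed in \<open>auto simp: A_def\<close>)
    then have "measure \<mu> (A n) * ?g * measure \<gamma> UNIV \<le> measure \<gamma> U * ?m * measure \<gamma> UNIV"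
      by (rule mult_right_mono) simp
    also have "\<dots> = (measure \<gamma> U * measure \<mu> UNIV) * ?g" using total by (simp add: algebra_simps)
    finally have "(measure \<mu> (A n) * measure \<gamma> UNIV) * ?g \<le> (measure \<gamma> U * measure \<mu> UNIV) * ?g"
      by (simp add: algebra_simps)
    then show ?thesis using pos by (rule mult_right_le_imp_le)
  qed
  have "(\<Union>n. A n) = U"
  proof (intro equalityI subsetI)
    fix x assume "x \<in> (\<Union>n. A n)"
    then obtain n where "ball x (1 / real (Suc n)) \<subseteq> U" by (auto simp: A_def)
    then show "x \<in> U" by (meson centre_in_ball subsetD divide_pos_pos of_nat_0_less_iff zero_less_Suc zero_less_one)
  next
    fix x assume "x \<in> U"
    then obtain e where e: "e > 0" "ball x e \<subseteq> U" using U by (meson open_contains_ball)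
    obtain n where "inverse (real (Suc n)) < e" using reals_Archimedean[OF e(1)] by blast
    then have "ball x (1 / real (Suc n)) \<subseteq> ball x e" by (intro subset_ball) (simp add: inverse_eq_divide)
    then show "x \<in> (\<Union>n. A n)" using e(2) by (auto simp: A_def)
  qed
  moreover have "incseq A"
  proof (rule incseq_SucI)
    fix n show "A n \<subseteq> A (Suc n)"
      unfolding A_def using subset_ball[of "1 / real (Suc (Suc n))" "1 / real (Suc n)"]
      by (fastforce simp: frac_le)
  qed
  ultimately have "(\<lambda>n. measure \<mu> (A n)) \<longlonglongrightarrow> measure \<mu> U"
    using M.finite_Lim_measure_incseq[of A] A_closed by (simp add: image_subset_iff)
  then have "(\<lambda>n. measure \<mu> (A n) * measure \<gamma> UNIV) \<longlonglongrightarrow> measure \<mu> U * measure \<gamma> UNIV"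
    by (intro tendsto_intros)
  then show ?thesis by (rule LIMSEQ_le_const2) (use A_le in auto)
qed (simp add: zero_less_measure_iff)

text \<open>
  Christensen's uniqueness principle. The preceding inequality and its mirror image give equality on open sets, which
  form an intersection-stable generator of the Borel sets.
\<close>

lemma uniformly_distributed_unique:
  fixes \<mu> \<gamma> :: "'a::{metric_space, second_countable_topology} measure"
  assumes \<mu>: "uniformly_distributed_on S \<mu>" and \<gamma>: "uniformly_distributed_on S \<gamma>"
    and s: "s \<in> S" and A: "A \<in> sets borel"
  shows "measure \<mu> A * measure \<gamma> UNIV = measure \<gamma> A * measure \<mu> UNIV"
proof -
  interpret M: finite_measure \<mu> using \<mu> by (simp add: uniformly_distributed_on_def)
  interpret G: finite_measure \<gamma> using \<gamma> by (simp add: uniformly_distributed_on_def)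
  have [measurable_cong, simp]: "sets \<mu> = sets borel" "sets \<gamma> = sets borel"
    using \<mu> \<gamma> by (auto simp: uniformly_distributed_on_def)
  let ?m = "scale_measure (ennreal (measure \<gamma> UNIV)) \<mu>"
  let ?g = "scale_measure (ennreal (measure \<mu> UNIV)) \<gamma>"
  have "?m = ?g"
  proof (rule measure_eqI_generator_eq[where E = "{U. open U}" and \<Omega> = UNIV and A = "\<lambda>_. UNIV"])
    fix U :: "'a set" assume "U \<in> {U. open U}"
    then have "measure \<mu> U * measure \<gamma> UNIV = measure \<gamma> U * measure \<mu> UNIV"
      using uniformly_distributed_open_le[OF \<mu> \<gamma> s, of U]
        uniformly_distributed_open_le[OF \<gamma> \<mu> s, of U] by simp
    then show "emeasure ?m U = emeasure ?g U"
      by (simp add: M.emeasure_eq_measure G.emeasure_eq_measure mult.commute flip: ennreal_mult)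
  qed (simp_all add: Int_stable_def open_Int sets_borel M.emeasure_eq_measure flip: ennreal_mult)
  then have "emeasure ?m A = emeasure ?g A" by simp
  then show ?thesis
    by (simp add: M.emeasure_eq_measure G.emeasure_eq_measure mult.commute flip: ennreal_mult)
qed

text \<open>
  Both upper variations of the restriction of \<open>\<nu>\<close> to \<open>S\<close> are invariant, and transitivity by
  isometries makes them uniformly distributed on \<open>S\<close>. Each is therefore proportional to \<open>\<gamma>\<close>, and so is
  their difference.
\<close>

lemma transitive_invariant_signed_measure_unique:
  fixes \<nu> :: "'a::{metric_space, second_countable_topology} set \<Rightarrow> real" and \<gamma> :: "'a measure"
  assumes \<nu>: "signed_measure_on borel \<nu>" and S: "S \<in> sets borel"
    and \<gamma>: "finite_measure \<gamma>" "sets \<gamma> = sets borel" "AE x in \<gamma>. x \<in> S"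
    and isom: "\<And>f. f \<in> G \<Longrightarrow> surj f" "\<And>f x y. f \<in> G \<Longrightarrow> dist (f x) (f y) = dist x y"
    and GS: "\<And>f. f \<in> G \<Longrightarrow> f ` S = S"
    and \<nu>_inv: "\<And>f A. f \<in> G \<Longrightarrow> A \<in> sets borel \<Longrightarrow> \<nu> (f ` A) = \<nu> A"
    and \<gamma>_inv: "\<And>f A. f \<in> G \<Longrightarrow> A \<in> sets borel \<Longrightarrow> measure \<gamma> (f ` A) = measure \<gamma> A"
    and trans: "\<And>x y. x \<in> S \<Longrightarrow> y \<in> S \<Longrightarrow> \<exists>f\<in>G. f x = y"
    and A: "A \<in> sets borel" "A \<subseteq> S"
  shows "\<nu> A * measure \<gamma> S = measure \<gamma> A * \<nu> S"
proof (cases "S = {}")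
  case True
  then show ?thesis using A signed_measure_on_empty[OF \<nu>] by simp
next
  case False
  then obtain s where s: "s \<in> S" by auto
  have bij: "bij f" if "f \<in> G" for f
    using isom[OF that] by (metis (no_types) bijI dist_eq_0_iff injI)
  have cont: "continuous_on UNIV f" "continuous_on UNIV (inv f)" if f: "f \<in> G" for f
  proof -
    show "continuous_on UNIV f"
      using isom(2)[OF f] by (intro lipschitz_on_continuous_on[of 1] lipschitz_onI) auto
    have "dist (inv f x) (inv f y) = dist x y" for x y
      using isom(2)[OF f, of "inv f x" "inv f y"] isom(1)[OF f] by (simp add: surj_f_inv_f)
    then show "continuous_on UNIV (inv f)"
      by (intro lipschitz_on_continuous_on[of 1] lipschitz_onI) auto
  qed
  have vimage: "f -` B \<in> sets borel" and image: "f ` B \<in> sets borel"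
    if f: "f \<in> G" and B: "B \<in> sets borel" for f B
  proof -
    show "f -` B \<in> sets borel"
      using measurable_sets[OF borel_measurable_continuous_onI[OF cont(1)[OF f]], of B] B by simp
    have "inv f -` B \<in> sets borel"
      using measurable_sets[OF borel_measurable_continuous_onI[OF cont(2)[OF f]], of B] B by simp
    then show "f ` B \<in> sets borel" by (simp add: bij_vimage_eq_inv_image[OF bij_imp_bij_inv[OF bij[OF f]]] inv_inv_eq[OF bij[OF f]])
  qed
  have image_ball: "f ` ball x r = ball (f x) r" if f: "f \<in> G" for f x r
  proof (intro equalityI subsetI)
    fix y assume "y \<in> ball (f x) r"
    moreover obtain z where "y = f z" using isom(1)[OF f] by blast
    ultimately show "y \<in> f ` ball x r" using isom(2)[OF f] by simp
  qed (use isom(2)[OF f] in auto)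
  have "space \<gamma> = UNIV" using \<gamma>(2) by (simp add: sets_eq_imp_space_eq[of _ borel])
  have u_\<gamma>: "uniformly_distributed_on S \<gamma>"
    unfolding uniformly_distributed_on_def
  proof (intro conjI \<gamma> ballI allI)
    fix x y r assume "x \<in> S" "y \<in> S"
    then obtain f where "f \<in> G" "f x = y" using trans by blast
    then show "measure \<gamma> (ball x r) = measure \<gamma> (ball y r)"
      using \<gamma>_inv[of f "ball x r"] image_ball by simp
  qed
  have unique: "measure (upper_variation_measure borel \<mu>) A * measure \<gamma> S
      = measure \<gamma> A * measure (upper_variation_measure borel \<mu>) S"
    if \<mu>: "signed_measure_on borel \<mu>"
      and inv: "\<And>f A. f \<in> G \<Longrightarrow> A \<in> sets borel \<Longrightarrow> \<mu> (f ` A) = \<mu> A"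
      and conc: "\<And>A. A \<in> sets borel \<Longrightarrow> A \<inter> S = {} \<Longrightarrow> \<mu> A = 0" for \<mu>
  proof -
    let ?M = "upper_variation_measure borel \<mu>"
    have "upper_variation borel \<mu> (- S) \<le> 0"
      unfolding upper_variation_def by (rule SUP_least) (use conc in \<open>auto simp: disjoint_eq_subset_Compl\<close>)
    then have "- S \<in> null_sets ?M"
      using S by (intro null_setsI) (auto simp: emeasure_upper_variation_measure[OF \<mu>])
    then have AE: "AE x in ?M. x \<in> S"
      using AE_not_in[of "- S" ?M] by simp
    have u_\<mu>: "uniformly_distributed_on S ?M"
      unfolding uniformly_distributed_on_def
    proof (intro conjI finite_measure_upper_variation_measure[OF \<mu>] AE ballI allI)
      fix x y r assume "x \<in> S" "y \<in> S"
      then obtain f where f: "f \<in> G" "f x = y" using trans by blast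
      have "upper_variation borel \<mu> (f ` ball x r) = upper_variation borel \<mu> (ball x r)"
        using f(1) by (intro upper_variation_image_invariant bij inv image vimage)
      then show "measure ?M (ball x r) = measure ?M (ball y r)"
        using f image_ball by (simp add: measure_def emeasure_upper_variation_measure[OF \<mu>])
    qed simp
    have "measure ?M UNIV = measure ?M S"
      using S AE by (intro measure_eq_AE) auto
    moreover have "measure \<gamma> UNIV = measure \<gamma> S"
      using S \<gamma> by (intro measure_eq_AE) auto
    ultimately show ?thesis using uniformly_distributed_unique[OF u_\<mu> u_\<gamma> s A(1)] by simp
  qed
  define \<nu>S where "\<nu>S B = \<nu> (B \<inter> S)" for B
  have \<nu>S: "signed_measure_on borel \<nu>S"
    unfolding signed_measure_on_def
  proof (intro allI impI)
    fix B :: "nat \<Rightarrow> 'a set" assume B: "range B \<subseteq> sets borel" "disjoint_family B"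
    have "(\<lambda>i. \<nu> (B i \<inter> S)) sums \<nu> (\<Union>i. B i \<inter> S)"
      by (rule signed_measure_onD[OF \<nu>]) (use B S in \<open>auto simp: disjoint_family_on_def\<close>)
    then show "(\<lambda>i. \<nu>S (B i)) sums \<nu>S (\<Union>i. B i)" by (simp add: \<nu>S_def)
  qed
  have inv: "\<nu>S (f ` B) = \<nu>S B" if f: "f \<in> G" and B: "B \<in> sets borel" for f B
  proof -
    have "f ` B \<inter> S = f ` (B \<inter> S)"
      using GS[OF f] bij[OF f] by (metis bij_def image_Int)
    then show ?thesis using \<nu>_inv[OF f, of "B \<inter> S"] B S by (simp add: \<nu>S_def)
  qed
  have conc: "\<nu>S B = 0" if "B \<inter> S = {}" for B
    using that signed_measure_on_empty[OF \<nu>] by (simp add: \<nu>S_def)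
  let ?P = "upper_variation_measure borel \<nu>S" and ?N = "upper_variation_measure borel (\<lambda>A. - \<nu>S A)"
  have "measure ?P A * measure \<gamma> S = measure \<gamma> A * measure ?P S"
    using inv conc by (intro unique[OF \<nu>S]) simp_all
  moreover have "measure ?N A * measure \<gamma> S = measure \<gamma> A * measure ?N S"
    using inv conc by (intro unique[OF signed_measure_on_uminus[OF \<nu>S]]) simp_all
  ultimately have "\<nu>S A * measure \<gamma> S = measure \<gamma> A * \<nu>S S"
    unfolding upper_variation_decomposition[OF \<nu>S A(1)] upper_variation_decomposition[OF \<nu>S S]
    by (simp only: left_diff_distrib right_diff_distrib)
  then show ?thesis using A(2) by (simp add: \<nu>S_def Int_absorb2)
qed

section \<open>The standard Gaussian measure\<close>

lemma std_gaussian_eq_density_norm: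
  "(std_gaussian :: (real^'n) measure) =
     density lborel (\<lambda>x. ennreal ((1 / sqrt (2 * pi)) ^ CARD('n) * exp (- (norm x)\<^sup>2 / 2)))"
proof -
  have "(\<Prod>i\<in>UNIV. ennreal (std_normal_density (x $ i)))
      = ennreal ((1 / sqrt (2 * pi)) ^ CARD('n) * exp (- (norm x)\<^sup>2 / 2))" for x :: "real^'n"
  proof -
    have "(\<Sum>i\<in>UNIV. - (x $ i)\<^sup>2 / 2) = - (norm x)\<^sup>2 / 2"
      by (simp add: norm_vec_def L2_set_def sum_nonneg sum_negf flip: sum_divide_distrib)
    then have "(\<Prod>i\<in>UNIV. std_normal_density (x $ i))
        = (1 / sqrt (2 * pi)) ^ CARD('n) * exp (- (norm x)\<^sup>2 / 2)"
      by (simp only: std_normal_density_def prod.distrib prod_constant exp_sum[symmetric] finite)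
    then show ?thesis by (simp add: prod_ennreal)
  qed
  then show ?thesis unfolding std_gaussian_def by simp
qed

lemma sets_std_gaussian [simp, measurable_cong]: "sets std_gaussian = sets borel"
  by (simp add: std_gaussian_def)

lemma space_std_gaussian [simp]: "space std_gaussian = UNIV"
  by (simp add: std_gaussian_def)

lemma prob_space_std_gaussian: "prob_space (std_gaussian :: (real^'n) measure)"
proof (rule prob_spaceI)
  have bij: "bij_betw (\<lambda>i. axis i 1) (UNIV :: 'n set) (Basis :: (real^'n) set)"
    by (auto simp: bij_betw_def inj_on_def axis_eq_axis Basis_vec_def)
  have one: "(\<integral>\<^sup>+x. ennreal (std_normal_density x) \<partial>lborel) = 1"
  proof -
    interpret N: prob_space "density lborel std_normal_density"
      by (rule prob_space_normal_density) simp
    show ?thesis using N.emeasure_space_1 by (simp add: emeasure_density)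
  qed
  have "emeasure std_gaussian (space std_gaussian :: (real^'n) set)
      = (\<integral>\<^sup>+x. (\<Prod>i\<in>UNIV. ennreal (std_normal_density (x $ i))) \<partial>(lborel :: (real^'n) measure))"
    by (simp add: std_gaussian_def emeasure_density)
  also have "\<dots> = (\<integral>\<^sup>+x. (\<Prod>b\<in>Basis. ennreal (std_normal_density (x \<bullet> b))) \<partial>(lborel :: (real^'n) measure))"
    by (simp add: prod.reindex_bij_betw[OF bij, symmetric] cart_eq_inner_axis)
  also have "\<dots> = 1"
    by (subst nn_integral_lborel_prod) (simp_all add: one)
  finally show "emeasure std_gaussian (space std_gaussian :: (real^'n) set) = 1" .
qed

lemma nn_integral_lborel_translate:
  fixes h :: "'a::euclidean_space \<Rightarrow> ennreal"
  assumes [measurable]: "h \<in> borel_measurable borel"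
  shows "(\<integral>\<^sup>+x. h (x + c) \<partial>lborel) = (\<integral>\<^sup>+x. h x \<partial>lborel)"
proof -
  have "(\<integral>\<^sup>+x. h x \<partial>lborel) = (\<integral>\<^sup>+x. h x \<partial>(distr lborel borel ((+) c)))"
    by (simp only: lborel_distr_plus)
  also have "\<dots> = (\<integral>\<^sup>+x. h (c + x) \<partial>lborel)" by (rule nn_integral_distr) simp_all
  finally show ?thesis by (simp add: add.commute)
qed

text \<open>
  Write \<open>\<lambda>\<close> for Lebesgue measure and \<open>B\<close> for the unit ball. Translation invariance and Fubini's theorem
  give \<open>\<lambda> (f -` A) * \<lambda> B = \<lambda> A * \<lambda> (f -` uminus ` B)\<close>, the argument that proves uniqueness of Haar measure.
  The ball is symmetric and invariant under \<open>f\<close>, so \<open>\<lambda> B\<close> cancels.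
\<close>

lemma distr_lborel_orthogonal_transformation:
  fixes f :: "'a::euclidean_space \<Rightarrow> 'a"
  assumes f: "orthogonal_transformation f"
  shows "distr lborel borel f = lborel"
proof (rule measure_eqI)
  have lin: "linear f" by (rule orthogonal_transformation_linear[OF f])
  have f_meas [measurable]: "f \<in> borel_measurable borel"
    using lin by (intro borel_measurable_continuous_onI linear_continuous_on) (simp add: linear_linear)
  have f_inv: "f (inv f y) = y" for y
    using orthogonal_transformation_surj[OF f] by (rule surj_f_inv_f)
  have f_shift: "f x + y = f (x + inv f y)" for x y
    by (simp add: linear_add[OF lin] f_inv)
  fix A assume "A \<in> sets (distr lborel borel f)"
  then have A [measurable]: "A \<in> sets borel" by simp
  let ?B = "ball (0::'a) 1"
  let ?b = "emeasure lborel ?B"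
  have B [measurable]: "?B \<in> sets borel" by simp
  have "emeasure lborel (f -` A) * ?b
      = (\<integral>\<^sup>+y. \<integral>\<^sup>+x. indicator A (f x) * indicator ?B y \<partial>lborel \<partial>lborel)"
  proof -
    have "f -` A \<in> sets borel" using measurable_sets[OF f_meas A] by simp
    then have "(\<integral>\<^sup>+x. indicator A (f x) \<partial>lborel) = emeasure lborel (f -` A)"
      by (simp add: indicator_vimage[symmetric])
    then show ?thesis by (simp add: nn_integral_multc nn_integral_cmult)
  qed
  also have "\<dots> = (\<integral>\<^sup>+y. \<integral>\<^sup>+x. indicator A (f x + y) * indicator ?B y \<partial>lborel \<partial>lborel)"
    unfolding f_shift
    by (rule nn_integral_cong, rule nn_integral_lborel_translate[symmetric]) measurable
  also have "\<dots> = (\<integral>\<^sup>+x. \<integral>\<^sup>+y. indicator A (f x + y) * indicator ?B y \<partial>lborel \<partial>lborel)"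
    by (rule lborel_pair.Fubini') measurable
  \<comment> \<open>Substituting \<open>y - f x\<close> for \<open>y\<close> moves the translation from \<open>A\<close> to the ball.\<close>
  also have "\<dots> = (\<integral>\<^sup>+x. \<integral>\<^sup>+y. indicator A y * indicator ?B (y - f x) \<partial>lborel \<partial>lborel)"
  proof (rule nn_integral_cong)
    fix x
    show "(\<integral>\<^sup>+y. indicator A (f x + y) * indicator ?B y \<partial>lborel)
        = (\<integral>\<^sup>+y. indicator A y * indicator ?B (y - f x) \<partial>lborel)"
      using nn_integral_lborel_translate[of "\<lambda>y. indicator A y * indicator ?B (y - f x)" "f x"]
      by (simp add: add.commute)
  qed
  also have "\<dots> = (\<integral>\<^sup>+y. \<integral>\<^sup>+x. indicator A y * indicator ?B (y - f x) \<partial>lborel \<partial>lborel)"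
    by (rule lborel_pair.Fubini') measurable
  also have "\<dots> = (\<integral>\<^sup>+y. indicator A y * ?b \<partial>lborel)"
  proof (rule nn_integral_cong)
    fix y
    have "indicator ?B (y - f x) = (indicator ?B (x + - inv f y) :: ennreal)" for x
    proof -
      have "y - f x = - f (x + - inv f y)"
        by (simp add: linear_diff[OF lin] f_inv)
      then show ?thesis by (simp add: indicator_def orthogonal_transformation_norm[OF f])
    qed
    then have "(\<integral>\<^sup>+x. indicator ?B (y - f x) \<partial>lborel) = (\<integral>\<^sup>+x. indicator ?B (x + - inv f y) \<partial>lborel)"
      by simp
    also have "\<dots> = ?b"
      by (subst nn_integral_lborel_translate) simp_all
    finally show "(\<integral>\<^sup>+x. indicator A y * indicator ?B (y - f x) \<partial>lborel) = indicator A y * ?b"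
      by (simp add: nn_integral_cmult)
  qed
  also have "\<dots> = emeasure lborel A * ?b" by (simp add: nn_integral_multc)
  finally have "emeasure lborel (f -` A) * ?b = emeasure lborel A * ?b" .
  moreover have "?b \<noteq> 0" "?b \<noteq> \<infinity>"
    using emeasure_lborel_ball_finite[of "0::'a" 1] content_ball_pos[of 1 "0::'a"]
    by (auto simp: measure_def)
  ultimately have "emeasure lborel (f -` A) = emeasure lborel A"
    by (metis ennreal_mult_cancel_left infinity_ennreal_def mult.commute)
  then show "emeasure (distr lborel borel f) A = emeasure lborel A"
    by (simp add: emeasure_distr)
qed simp

text \<open>
  The Gaussian density depends on the norm only, and Lebesgue measure is invariant.
\<close>

lemma measure_std_gaussian_orthogonal_vimage:
  fixes f :: "real^'n \<Rightarrow> real^'n"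
  assumes f: "orthogonal_transformation f" and A: "A \<in> sets borel"
  shows "measure std_gaussian (f -` A) = measure std_gaussian A"
proof -
  have f_meas [measurable]: "f \<in> borel_measurable borel"
    using f by (intro borel_measurable_continuous_onI linear_continuous_on)
      (simp add: linear_linear orthogonal_transformation_linear)
  let ?d = "\<lambda>x :: real^'n. ennreal ((1 / sqrt (2 * pi)) ^ CARD('n) * exp (- (norm x)\<^sup>2 / 2))"
  have fA: "f -` A \<in> sets borel" using measurable_sets[OF f_meas A] by simp
  have "emeasure std_gaussian A = (\<integral>\<^sup>+x. ?d x * indicator A x \<partial>lborel)"
    using A by (simp add: std_gaussian_eq_density_norm emeasure_density)
  also have "\<dots> = (\<integral>\<^sup>+x. ?d x * indicator A x \<partial>(distr lborel borel f))"
    by (simp only: distr_lborel_orthogonal_transformation[OF f])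
  also have "\<dots> = (\<integral>\<^sup>+x. ?d (f x) * indicator A (f x) \<partial>lborel)"
    using A by (subst nn_integral_distr) simp_all
  also have "\<dots> = (\<integral>\<^sup>+x. ?d x * indicator (f -` A) x \<partial>lborel)"
    by (simp add: orthogonal_transformation_norm[OF f] indicator_vimage)
  also have "\<dots> = emeasure std_gaussian (f -` A)"
    using fA by (simp add: std_gaussian_eq_density_norm emeasure_density)
  finally show ?thesis by (simp add: measure_def)
qed

text \<open>
  A proper subspace is Lebesgue null. This concentrates the pair of projections of a Gaussian vector on the
  generic orbit in \<open>L \<times> L\<^sup>\<bottom>\<close>.
\<close>

lemma AE_std_gaussian_notin_subspace:
  fixes V :: "(real^'n) set"
  assumes V: "subspace V" "V \<noteq> UNIV"
  shows "AE g in std_gaussian. g \<notin> V"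
proof -
  have "negligible V"
  proof (rule negligible_lowdim)
    have "dim V \<noteq> DIM(real^'n)"
      using V dim_eq_full[of V] V(1)[folded span_eq_iff] by simp
    then show "dim V < DIM(real^'n)" using dim_subset_UNIV[of V] by simp
  qed
  then have "V \<in> null_sets lborel"
    using V(1) by (simp add: negligible_iff_null_sets null_sets_completion_iff closed_subspace borel_closed)
  then have "AE g in lborel. g \<notin> V" by (rule AE_not_in)
  then show ?thesis
    unfolding std_gaussian_eq_density_norm by (subst AE_density) auto
qed

section \<open>Polar cones and the Moreau decomposition\<close>

lemma closed_polar_cone: "closed (polar_cone C)"
proof -
  have "polar_cone C = (\<Inter>x\<in>C. {z. x \<bullet> z \<le> 0})" by (auto simp: polar_cone_def)
  then show ?thesis by (auto intro!: closed_INT closed_halfspace_le)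
qed

lemma convex_polar_cone: "convex (polar_cone C)"
proof -
  have "polar_cone C = (\<Inter>x\<in>C. {z. x \<bullet> z \<le> 0})" by (auto simp: polar_cone_def)
  then show ?thesis by (auto intro!: convex_INT convex_halfspace_le)
qed

lemma scaleR_mem_polar_cone: "z \<in> polar_cone C \<Longrightarrow> 0 \<le> t \<Longrightarrow> t *\<^sub>R z \<in> polar_cone C"
  by (auto simp: polar_cone_def intro: mult_nonneg_nonpos)

lemma zero_mem_polar_cone [simp]: "0 \<in> polar_cone C"
  by (simp add: polar_cone_def)

lemma polar_cone_subspace:
  assumes "subspace L"
  shows "polar_cone L = {z. \<forall>x\<in>L. x \<bullet> z = 0}"
proof (intro equalityI subsetI CollectI ballI)
  fix z x assume "z \<in> polar_cone L" "x \<in> L"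
  then have "x \<bullet> z \<le> 0" "(- x) \<bullet> z \<le> 0"
    using subspace_neg[OF assms] unfolding polar_cone_def by blast+
  then show "x \<bullet> z = 0" by simp
qed (auto simp: polar_cone_def)

lemma subspace_polar_cone_subspace: "subspace L \<Longrightarrow> subspace (polar_cone L)"
  by (auto simp: polar_cone_subspace subspace_def inner_add_right)

lemma biconic_lift_subspace: "subspace L \<Longrightarrow> biconic_lift L = L \<times> polar_cone L"
  by (auto simp: biconic_lift_def polar_cone_subspace)

definition moreau_pair :: "(real^'n) set \<Rightarrow> real^'n \<Rightarrow> (real^'n) \<times> (real^'n)" where
  "moreau_pair C g = (closest_point C g, closest_point (polar_cone C) g)"

text \<open>
  The displacement from \<open>x\<close> to any other point of \<open>C\<close> has nonpositive inner product with \<open>z\<close>, so it cannot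
  shorten the distance to \<open>x + z\<close>. The same holds with the components exchanged, since \<open>x\<close> is nonpositive
  on the polar cone.
\<close>

lemma biconic_lift_imp_closest_point:
  assumes C: "closed C" "convex C" and xz: "(x, z) \<in> biconic_lift C"
  shows "closest_point C (x + z) = x" "closest_point (polar_cone C) (x + z) = z"
proof -
  have nearest: "norm b \<le> norm (b - v)" if "b \<bullet> v \<le> 0" for b v :: "real^'n"
  proof -
    have "(norm b)\<^sup>2 \<le> (norm (b - v))\<^sup>2"
      using that inner_ge_zero[of v]
      by (simp only: power2_norm_eq_inner inner_diff_left inner_diff_right inner_commute[of v b])
    then show ?thesis by (rule power2_le_imp_le) simp
  qed
  have "dist (x + z) x \<le> dist (x + z) y" if "y \<in> C" for y
    using nearest[of z "y - x"] xz that
    by (simp add: dist_norm biconic_lift_def polar_cone_def inner_diff inner_commute algebra_simps)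
  then show "closest_point C (x + z) = x"
    using C xz by (intro closest_point_unique[symmetric]) (auto simp: biconic_lift_def)
  have "dist (x + z) z \<le> dist (x + z) w" if "w \<in> polar_cone C" for w
    using nearest[of x "w - z"] xz that
    by (simp add: dist_norm biconic_lift_def polar_cone_def inner_diff_right algebra_simps)
  then show "closest_point (polar_cone C) (x + z) = z"
    using xz by (intro closest_point_unique[symmetric] closed_polar_cone convex_polar_cone)
      (auto simp: biconic_lift_def)
qed

lemma closest_point_cone_residual:
  assumes C: "closed C" "convex C" "cone C" "0 \<in> C"
  shows "(closest_point C g, g - closest_point C g) \<in> biconic_lift C"
proof -
  let ?x = "closest_point C g"
  have x: "?x \<in> C" using C by (intro closest_point_in_set) auto
  have dot: "(g - ?x) \<bullet> (y - ?x) \<le> 0" if "y \<in> C" for y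
    using C that by (intro closest_point_dot)
  \<comment> \<open>The variational inequality at the points \<open>2 x\<close> and 0 of the cone shows that the residual is orthogonal to \<open>x\<close>.\<close>
  have "2 *\<^sub>R ?x \<in> C" using \<open>cone C\<close> x by (simp add: cone_def)
  from dot[OF this] dot[OF \<open>0 \<in> C\<close>] have orth: "(g - ?x) \<bullet> ?x = 0"
    by (simp add: inner_diff scaleR_2)
  moreover have "(g - ?x) \<bullet> y \<le> 0" if "y \<in> C" for y
    using dot[OF that] orth by (simp add: inner_diff_right)
  ultimately show ?thesis
    using x by (auto simp: biconic_lift_def polar_cone_def inner_commute)
qed

text \<open>
  Moreau's theorem: \<open>g\<close> has exactly one decomposition into orthogonal components from \<open>C\<close> and from
  its polar cone, and the metric projections compute it. The biconic lift is the set of all pairs that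
  arise in this way.
\<close>

lemma moreau_pair_eq_iff:
  assumes C: "closed C" "convex C" "cone C" "0 \<in> C"
  shows "moreau_pair C g = (x, z) \<longleftrightarrow> (x, z) \<in> biconic_lift C \<and> x + z = g"
proof
  let ?x = "closest_point C g"
  have BL: "(?x, g - ?x) \<in> biconic_lift C" by (rule closest_point_cone_residual[OF C])
  from biconic_lift_imp_closest_point(2)[OF C(1,2) BL]
  have "moreau_pair C g = (?x, g - ?x)" by (simp add: moreau_pair_def)
  then show "moreau_pair C g = (x, z) \<Longrightarrow> (x, z) \<in> biconic_lift C \<and> x + z = g"
    using BL by auto
  show "(x, z) \<in> biconic_lift C \<and> x + z = g \<Longrightarrow> moreau_pair C g = (x, z)"
    using biconic_lift_imp_closest_point[OF C(1,2)] by (auto simp: moreau_pair_def)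
qed

lemma subspace_imp_closed_convex_cone:
  fixes L :: "(real^'n) set"
  assumes "subspace L"
  shows "closed L" "convex L" "cone L" "0 \<in> L"
  using assms by (auto simp: closed_subspace subspace_imp_convex subspace_imp_cone subspace_0)

lemma borel_measurable_moreau_pair:
  assumes C: "closed C" "convex C" "0 \<in> C"
  shows "moreau_pair C \<in> borel_measurable borel"
proof -
  have "continuous_on UNIV (closest_point C)"
    using C by (intro continuous_on_closest_point) auto
  moreover have "continuous_on UNIV (closest_point (polar_cone C))"
    using zero_mem_polar_cone[of C]
    by (intro continuous_on_closest_point convex_polar_cone closed_polar_cone) blast
  ultimately show ?thesis
    unfolding moreau_pair_def[abs_def]
    by (intro borel_measurable_continuous_onI continuous_on_Pair)
qed

lemma orthogonal_transformation_image_polar: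
  fixes f :: "real^'n \<Rightarrow> real^'n"
  assumes f: "orthogonal_transformation f"
  shows "f ` polar_cone C = polar_cone (f ` C)"
proof (intro equalityI subsetI)
  fix z assume "z \<in> f ` polar_cone C"
  then show "z \<in> polar_cone (f ` C)" using f by (auto simp: polar_cone_def orthogonal_transformation_def)
next
  fix z assume z: "z \<in> polar_cone (f ` C)"
  obtain w where w: "z = f w" using orthogonal_transformation_surj[OF f] by blast
  then have "w \<in> polar_cone C" using z f by (auto simp: polar_cone_def orthogonal_transformation_def)
  then show "z \<in> f ` polar_cone C" using w by blast
qed

lemma moreau_pair_orthogonal_transformation:
  fixes f :: "real^'n \<Rightarrow> real^'n"
  assumes f: "orthogonal_transformation f" and L: "subspace L" and fL: "f ` L = L"
  shows "moreau_pair L (f g) = map_prod f f (moreau_pair L g)"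
proof -
  note LC = subspace_imp_closed_convex_cone[OF L]
  obtain x z where xz: "moreau_pair L g = (x, z)" by (cases "moreau_pair L g")
  then have "(x, z) \<in> L \<times> polar_cone L" "x + z = g"
    using moreau_pair_eq_iff[OF LC] biconic_lift_subspace[OF L] by auto
  moreover have "f ` polar_cone L = polar_cone L"
    using orthogonal_transformation_image_polar[OF f, of L] fL by simp
  ultimately have "(f x, f z) \<in> L \<times> polar_cone L" "f x + f z = f g"
    using fL orthogonal_transformation_linear[OF f] by (auto simp: linear_add)
  then have "moreau_pair L (f g) = (f x, f z)"
    using moreau_pair_eq_iff[OF LC] biconic_lift_subspace[OF L] by auto
  then show ?thesis by (simp add: xz)
qed

section \<open>Polyhedral cones and the cells of their biconic lifts\<close>

lemma polyhedral_cone_props: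
  fixes C :: "(real^'n) set"
  assumes "C \<in> polyhedral_cones"
  shows "closed C" "convex C" "cone C" "0 \<in> C" "polyhedron C"
proof -
  obtain m and a :: "nat \<Rightarrow> real^'n" where C: "C = {x. \<forall>i<m. a i \<bullet> x \<le> 0}"
    using assms by (auto simp: polyhedral_cones_def)
  have "C = \<Inter> ((\<lambda>i. {x. a i \<bullet> x \<le> 0}) ` {..<m})" using C by auto
  moreover have "polyhedron (\<Inter> ((\<lambda>i. {x. a i \<bullet> x \<le> 0}) ` {..<m}))"
    by (rule polyhedron_Inter) (auto intro: polyhedron_halfspace_le)
  ultimately show P: "polyhedron C" by simp
  show "closed C" "convex C"
    using P by (auto intro: polyhedron_imp_closed polyhedron_imp_convex)
  show "cone C" "0 \<in> C"
    by (auto simp: C cone_def mult_nonneg_nonpos)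
qed

text \<open>
  The rows are the vectors of a basis of the orthogonal complement together with their negatives.
\<close>

lemma subspace_polyhedral_cone:
  fixes L :: "(real^'n) set"
  assumes L: "subspace L"
  shows "L \<in> polyhedral_cones"
proof -
  obtain B where B: "finite B" "span B = polar_cone L"
    using basis_exists[of "polar_cone L"] subspace_polar_cone_subspace[OF L]
    by (metis finiteI_independent span_subspace)
  have "finite (B \<union> uminus ` B)" using B by simp
  then obtain m and a :: "nat \<Rightarrow> real^'n" where a: "B \<union> uminus ` B = a ` {i. i < m}"
    using finite_imp_nat_seg_image_inj_on[of "B \<union> uminus ` B"] by blast
  have "x \<in> L \<longleftrightarrow> (\<forall>i<m. a i \<bullet> x \<le> 0)" for x
  proof
    assume x: "x \<in> L"
    show "\<forall>i<m. a i \<bullet> x \<le> 0"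
    proof (intro allI impI)
      fix i assume "i < m"
      then have "a i \<in> B \<union> uminus ` B" using a by blast
      moreover have "b \<bullet> x = 0" if "b \<in> B" for b
      proof -
        have "b \<in> polar_cone L" using B(2) span_base[OF that] by simp
        then show ?thesis
          using x inner_commute[of b x] by (simp add: polar_cone_subspace[OF L])
      qed
      ultimately show "a i \<bullet> x \<le> 0" by auto
    qed
  next
    assume x: "\<forall>i<m. a i \<bullet> x \<le> 0"
    have rows: "b \<bullet> x \<le> 0" if "b \<in> B \<union> uminus ` B" for b
      using that x unfolding a by auto
    have "b \<bullet> x = 0" if "b \<in> B" for b
      using rows[of b] rows[of "- b"] that by simp
    note B_orth = this
    have B0: "w \<bullet> x = 0" if "w \<in> polar_cone L" for w
      using that unfolding B(2)[symmetric]
      by (induction rule: span_induct_alt) (auto simp: inner_add_left B_orth)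
    obtain p q where pq: "moreau_pair L x = (p, q)" by (cases "moreau_pair L x")
    then have p: "p \<in> L" and q: "q \<in> polar_cone L" and x_eq: "x = p + q"
      using moreau_pair_eq_iff[OF subspace_imp_closed_convex_cone[OF L]] biconic_lift_subspace[OF L]
      by auto
    have "q \<bullet> p = 0" using p q by (simp add: polar_cone_subspace[OF L] inner_commute)
    then have "q \<bullet> q = 0" using B0[OF q] x_eq by (simp add: inner_add_right)
    then show "x \<in> L" using p x_eq by simp
  qed
  then show ?thesis unfolding polyhedral_cones_def by blast
qed

lemma mem_relative_interior_iff:
  "x \<in> top_of_set L interior_of (C \<inter> L) \<longleftrightarrow> x \<in> L \<and> (\<exists>e>0. ball x e \<inter> L \<subseteq> C)"
  (is "?lhs \<longleftrightarrow> ?rhs")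
proof
  assume ?lhs
  then obtain T where "openin (top_of_set L) T" "x \<in> T" "T \<subseteq> C \<inter> L"
    by (auto simp: interior_of_def)
  then show ?rhs by (auto simp: openin_contains_ball) (metis IntI subset_iff)
next
  assume ?rhs
  then obtain e where e: "x \<in> L" "e > 0" "ball x e \<inter> L \<subseteq> C" by blast
  have "openin (top_of_set L) (L \<inter> ball x e)" by (rule openin_open_Int) simp
  then show ?lhs
    using e unfolding interior_of_def by (intro CollectI exI[of _ "L \<inter> ball x e"]) auto
qed

text \<open>
  From a relative interior point \<open>x\<close> a short step in any direction of \<open>L\<close> stays in \<open>C\<close>, and \<open>z\<close> vanishes at
  \<open>x\<close> while being nonpositive on \<open>C\<close>. So \<open>z\<close> is nonpositive in every direction of \<open>L\<close>.
\<close>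

lemma polar_orthogonal_at_relative_interior:
  assumes L: "subspace L" and x: "x \<in> top_of_set L interior_of (C \<inter> L)"
    and z: "z \<in> polar_cone C" "x \<bullet> z = 0"
  shows "z \<in> polar_cone L"
  unfolding polar_cone_def
proof (intro CollectI ballI)
  fix y assume y: "y \<in> L"
  obtain e where e: "x \<in> L" "e > 0" "ball x e \<inter> L \<subseteq> C"
    using x by (auto simp: mem_relative_interior_iff)
  \<comment> \<open>The summand 1 keeps the denominator positive when \<open>y = 0\<close>.\<close>
  define t where "t = e / (2 * (norm y + 1))"
  have t: "t > 0" unfolding t_def using e by (intro divide_pos_pos mult_pos_pos add_nonneg_pos) simp_all
  have "t * norm y < e"
  proof -
    have "t * norm y \<le> t * (norm y + 1)" using t by simp
    also have "\<dots> = e / 2" by (simp add: t_def field_simps add_nonneg_eq_0_iff)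
    finally show ?thesis using e by simp
  qed
  then have "x + t *\<^sub>R y \<in> ball x e" using t by (simp add: dist_norm)
  moreover have "x + t *\<^sub>R y \<in> L" using e(1) y L by (simp add: subspace_add subspace_scale)
  ultimately have "x + t *\<^sub>R y \<in> C" using e by blast
  then have "(x + t *\<^sub>R y) \<bullet> z \<le> 0" using z by (simp add: polar_cone_def)
  then show "y \<bullet> z \<le> 0" using z t by (simp add: inner_add_left mult_le_0_iff)
qed

text \<open>
  The face is exposed by the sum of the constraint vectors that are active at \<open>x\<close>. On its span all these
  constraints hold with equality, and the inactive ones remain strict near \<open>x\<close>.
\<close>

lemma polyhedral_cone_point_in_face_interior:
  fixes C :: "(real^'n) set"
  assumes C: "C \<in> polyhedral_cones" and x: "x \<in> C"
  shows "\<exists>k\<le>CARD('n). \<exists>L\<in>face_spans k C. x \<in> top_of_set L interior_of (C \<inter> L)"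
proof -
  obtain m and a :: "nat \<Rightarrow> real^'n" where Ceq: "C = {x. \<forall>i<m. a i \<bullet> x \<le> 0}"
    using C by (auto simp: polyhedral_cones_def)
  define I where "I = {i. i < m \<and> a i \<bullet> x = 0}"
  have fin: "finite I" by (simp add: I_def)
  define z where "z = (\<Sum>i\<in>I. a i)"
  have yz: "y \<bullet> z = (\<Sum>i\<in>I. a i \<bullet> y)" for y
    by (simp add: z_def inner_sum_right inner_commute)
  have z: "z \<in> polar_cone C"
    by (auto simp: polar_cone_def yz Ceq I_def intro!: sum_nonpos)
  define F where "F = {y \<in> C. y \<bullet> z = 0}"
  have F: "F \<in> cone_faces C" using z unfolding cone_faces_def F_def by blast
  have FI: "a i \<bullet> y = 0" if "y \<in> F" "i \<in> I" for i y
  proof -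
    have "(\<Sum>i\<in>I. - (a i \<bullet> y)) = 0" using that(1) yz[of y] by (simp add: F_def sum_negf)
    moreover have "\<And>i. i \<in> I \<Longrightarrow> 0 \<le> - (a i \<bullet> y)" using that(1) by (simp add: F_def Ceq I_def)
    ultimately show ?thesis using sum_nonneg_eq_0_iff[OF fin, of "\<lambda>i. - (a i \<bullet> y)"] that(2) by simp
  qed
  have span_I: "a i \<bullet> y = 0" if "y \<in> span F" "i \<in> I" for i y
    using that(1) by (induction rule: span_induct_alt) (auto simp: inner_add_right FI that(2))
  have xF: "x \<in> F" using x by (simp add: F_def yz) (simp add: I_def)
  define N where "N = {i. i < m \<and> a i \<bullet> x < 0}"
  have "open (\<Inter>i\<in>N. {y. a i \<bullet> y < 0})"
    by (rule open_INT) (auto simp: N_def intro: open_halfspace_lt)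
  moreover have "x \<in> (\<Inter>i\<in>N. {y. a i \<bullet> y < 0})" by (simp add: N_def)
  ultimately obtain e where e: "e > 0" "ball x e \<subseteq> (\<Inter>i\<in>N. {y. a i \<bullet> y < 0})"
    by (meson open_contains_ball)
  have "ball x e \<inter> span F \<subseteq> C"
  proof
    fix y assume y: "y \<in> ball x e \<inter> span F"
    have "a i \<bullet> y \<le> 0" if i: "i < m" for i
    proof (cases "a i \<bullet> x = 0")
      case True
      then show ?thesis using span_I[of y i] y i by (simp add: I_def)
    next
      case False
      moreover have "a i \<bullet> x \<le> 0" using x i by (simp add: Ceq)
      ultimately have "i \<in> N" using i by (simp add: N_def)
      then show ?thesis using e(2) y by fastforce
    qed
    then show "y \<in> C" by (simp add: Ceq)
  qed
  then have "x \<in> top_of_set (span F) interior_of (C \<inter> span F)"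
    using e(1) xF span_base unfolding mem_relative_interior_iff by blast
  moreover have "span F \<in> face_spans (dim (span F)) C"
    using F unfolding face_spans_def by blast
  moreover have "dim (span F) \<le> CARD('n)" using dim_subset_UNIV[of "span F"] by simp
  ultimately show ?thesis by blast
qed

text \<open>
  The polar vector \<open>z'\<close> that exposes the second face vanishes at \<open>x\<close>, hence on all of \<open>L\<close>. So the second face
  contains the first.
\<close>

lemma face_interior_span_le:
  assumes L: "L \<in> face_spans k C" and L': "L' \<in> face_spans k' C"
    and x: "x \<in> top_of_set L interior_of (C \<inter> L)" and x': "x \<in> L'"
  shows "L \<subseteq> L'"
proof -
  obtain z where z: "z \<in> polar_cone C" and Leq: "L = span {y \<in> C. y \<bullet> z = 0}"
    using L by (auto simp: face_spans_def cone_faces_def)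
  obtain z' where z': "z' \<in> polar_cone C" and L'eq: "L' = span {y \<in> C. y \<bullet> z' = 0}"
    using L' by (auto simp: face_spans_def cone_faces_def)
  have "y \<bullet> z' = 0" if "y \<in> L'" for y
    using that unfolding L'eq by (induction rule: span_induct_alt) (auto simp: inner_add_left)
  then have "x \<bullet> z' = 0" using x' by blast
  then have "z' \<in> polar_cone L"
    using polar_orthogonal_at_relative_interior[of L x C z'] x z' Leq by simp
  then have "y \<bullet> z' = 0" if "y \<in> L" for y
    using that by (simp add: Leq polar_cone_subspace)
  then have "{y \<in> C. y \<bullet> z = 0} \<subseteq> {y \<in> C. y \<bullet> z' = 0}"
    unfolding Leq by (auto intro: span_base)
  then show ?thesis unfolding Leq L'eq by (rule span_mono)
qed

text \<open>
  Exposed faces are faces in the sense of convexity, and a polyhedron has only finitely many of these.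
\<close>

lemma finite_face_spans:
  assumes C: "C \<in> polyhedral_cones"
  shows "finite (face_spans k C)"
proof -
  have "F face_of C" if FC: "F \<in> cone_faces C" for F
  proof -
    obtain z where z: "z \<in> polar_cone C" and "F = {y \<in> C. y \<bullet> z = 0}"
      using FC unfolding cone_faces_def by blast
    then have F: "F = C \<inter> {y. z \<bullet> y = 0}"
      by (simp only: inner_commute[of _ z]) blast
    show ?thesis
      unfolding F using polyhedral_cone_props(2)[OF C] z
      by (intro face_of_Int_supporting_hyperplane_le) (auto simp: polar_cone_def inner_commute)
  qed
  then have "cone_faces C \<subseteq> {F. F face_of C}" by blast
  then have "finite (cone_faces C)"
    using finite_polyhedron_faces[OF polyhedral_cone_props(5)[OF C]] finite_subset by blast
  moreover have "face_spans k C \<subseteq> span ` cone_faces C" by (auto simp: face_spans_def)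
  ultimately show ?thesis using finite_surj by blast
qed

lemma face_spans_subspace: "L \<in> face_spans k C \<Longrightarrow> subspace L"
  and face_spans_dim: "L \<in> face_spans k C \<Longrightarrow> dim L = k"
  by (auto simp: face_spans_def)

text \<open>
  For the span \<open>L\<close> of a face this is the relative interior of the face times its normal cone.
\<close>

definition face_cell :: "(real^'n) set \<Rightarrow> (real^'n) set \<Rightarrow> ((real^'n) \<times> (real^'n)) set" where
  "face_cell C L = (top_of_set L interior_of (C \<inter> L)) \<times> (polar_cone C \<inter> polar_cone L)"

lemma face_cell_subset_biconic_lift:
  assumes "subspace L"
  shows "face_cell C L \<subseteq> biconic_lift C" "face_cell C L \<subseteq> biconic_lift L"
proof -
  have "top_of_set L interior_of (C \<inter> L) \<subseteq> C \<inter> L" by (rule interior_of_subset)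
  then show "face_cell C L \<subseteq> biconic_lift C" "face_cell C L \<subseteq> biconic_lift L"
    using assms by (auto simp: face_cell_def biconic_lift_def polar_cone_subspace)
qed

lemma biconic_lift_face_cell:
  assumes "subspace L" "(x, z) \<in> biconic_lift C" "x \<in> top_of_set L interior_of (C \<inter> L)"
  shows "(x, z) \<in> face_cell C L"
  using assms polar_orthogonal_at_relative_interior[of L x C z]
  by (auto simp: face_cell_def biconic_lift_def)

lemma biconic_lift_eq_Union_face_cells:
  fixes C :: "(real^'n) set"
  assumes C: "C \<in> polyhedral_cones"
  shows "biconic_lift C = (\<Union>k\<le>CARD('n). \<Union>L\<in>face_spans k C. face_cell C L)"
proof (intro equalityI subsetI)
  fix p assume p: "p \<in> biconic_lift C"
  obtain x z where xz: "p = (x, z)" by (cases p)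
  then have "x \<in> C" using p by (simp add: biconic_lift_def)
  then obtain k L where "k \<le> CARD('n)" and L: "L \<in> face_spans k C"
    and "x \<in> top_of_set L interior_of (C \<inter> L)"
    using polyhedral_cone_point_in_face_interior[OF C] by blast
  then show "p \<in> (\<Union>k\<le>CARD('n). \<Union>L\<in>face_spans k C. face_cell C L)"
    using biconic_lift_face_cell[OF face_spans_subspace[OF L]] p xz by blast
qed (use face_cell_subset_biconic_lift(1) face_spans_subspace in blast)

lemma face_cell_disjoint:
  assumes "L \<in> face_spans k C" "L' \<in> face_spans k' C" "face_cell C L \<inter> face_cell C L' \<noteq> {}"
  shows "L = L'"
proof -
  obtain x where "x \<in> top_of_set L interior_of (C \<inter> L)" "x \<in> top_of_set L' interior_of (C \<inter> L')"
    using assms(3) by (auto simp: face_cell_def)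
  moreover from this have "x \<in> L" "x \<in> L'" by (auto simp: mem_relative_interior_iff)
  ultimately show ?thesis
    using face_interior_span_le[of L k C L' k' x] face_interior_span_le[of L' k' C L k x] assms(1,2)
    by blast
qed

section \<open>Biconic sets and measures\<close>

lemma biconic_sets_iff:
  fixes M :: "((real^'n) \<times> (real^'n)) set"
  shows "M \<in> biconic_sets \<longleftrightarrow> M \<in> sets borel \<and>
    (\<forall>s>0. \<forall>t>0. \<forall>x y. (s *\<^sub>R x, t *\<^sub>R y) \<in> M \<longleftrightarrow> (x, y) \<in> M)"
proof -
  have "(\<forall>s>0. \<forall>t>0. (\<lambda>(x, y). (s *\<^sub>R x, t *\<^sub>R y)) ` M = M) \<longleftrightarrow>
    (\<forall>s>0. \<forall>t>0. \<forall>x y. (s *\<^sub>R x, t *\<^sub>R y) \<in> M \<longleftrightarrow> (x, y) \<in> M)" (is "?l \<longleftrightarrow> ?r")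
  proof
    assume l: ?l
    have fwd: "(s *\<^sub>R x, t *\<^sub>R y) \<in> M" if "s > 0" "t > 0" "(x, y) \<in> M" for s t x y
      using l[rule_format, OF that(1,2)] that(3) by (metis (mono_tags, lifting) case_prod_conv image_eqI)
    show ?r
    proof (intro allI impI iffI)
      fix s t :: real and x y assume st: "s > 0" "t > 0" and "(s *\<^sub>R x, t *\<^sub>R y) \<in> M"
      from fwd[OF _ _ this(3), of "inverse s" "inverse t"] st show "(x, y) \<in> M" by simp
    qed (rule fwd)
  next
    assume r: ?r
    show ?l
    proof (intro allI impI equalityI subsetI)
      fix s t :: real and p assume st: "s > 0" "t > 0" and p: "p \<in> M"
      obtain x y where xy: "p = (x, y)" by (cases p)
      have "(inverse s *\<^sub>R x, inverse t *\<^sub>R y) \<in> M"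
        using r[rule_format, of "inverse s" "inverse t" x y] st p xy by simp
      then show "p \<in> (\<lambda>(x, y). (s *\<^sub>R x, t *\<^sub>R y)) ` M"
        using st xy by (intro image_eqI[of _ _ "(inverse s *\<^sub>R x, inverse t *\<^sub>R y)"]) auto
    qed (use r in auto)
  qed
  then show ?thesis unfolding biconic_sets_def by simp
qed

text \<open>
  Normalizing both components, with \<open>sgn 0 = 0\<close>, picks one point from every class of pairs that agree up
  to positive scaling of the components. Preimages of Borel sets are exactly the biconic sets, so
  biconic measures correspond to signed Borel measures.
\<close>

definition sgn_pair :: "(real^'n) \<times> (real^'n) \<Rightarrow> (real^'n) \<times> (real^'n)" where
  "sgn_pair = map_prod sgn sgn"

lemma sgn_pair_Pair: "sgn_pair (x, z) = (sgn x, sgn z)"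
  by (simp add: sgn_pair_def)

lemma borel_measurable_sgn_pair:
  "(sgn_pair :: (real^'n) \<times> (real^'n) \<Rightarrow> _) \<in> borel_measurable borel"
proof -
  have "(\<lambda>p::(real^'n) \<times> (real^'n). (sgn (fst p), sgn (snd p))) \<in> borel_measurable borel"
    by (intro borel_measurable_Pair measurable_compose[OF _ borel_measurable_sgn]
        borel_measurable_continuous_onI continuous_intros)
  moreover have "sgn_pair = (\<lambda>p::(real^'n) \<times> (real^'n). (sgn (fst p), sgn (snd p)))"
    by (simp add: fun_eq_iff sgn_pair_Pair)
  ultimately show ?thesis by simp
qed

lemma vimage_sgn_pair_biconic:
  assumes "A \<in> sets borel"
  shows "sgn_pair -` A \<in> biconic_sets"
  using measurable_sets[OF borel_measurable_sgn_pair assms]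
  by (auto simp: biconic_sets_iff sgn_pair_Pair sgn_scaleR)

lemma sgn_pair_mem_biconic_iff:
  assumes M: "M \<in> biconic_sets"
  shows "sgn_pair p \<in> M \<longleftrightarrow> p \<in> M"
proof -
  obtain x z where p: "p = (x, z)" by (cases p)
  have scaled: "\<exists>s>0. sgn v = s *\<^sub>R v" for v :: "real^'n"
  proof (cases "v = 0")
    case True
    then show ?thesis by (intro exI[of _ 1]) simp
  next
    case False
    then show ?thesis by (intro exI[of _ "inverse (norm v)"]) (simp add: sgn_div_norm)
  qed
  obtain s t where "s > 0" "sgn x = s *\<^sub>R x" "t > 0" "sgn z = t *\<^sub>R z"
    using scaled by metis
  then show ?thesis using M by (simp add: p biconic_sets_iff sgn_pair_Pair)
qed

lemma vimage_sgn_pair_eq: "M \<in> biconic_sets \<Longrightarrow> sgn_pair -` M = M"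
  by (rule set_eqI) (simp only: vimage_eq sgn_pair_mem_biconic_iff)

lemma biconic_sets_borel: "M \<in> biconic_sets \<Longrightarrow> M \<in> sets borel"
  by (simp add: biconic_sets_iff)

lemma biconic_sets_Int: "M \<in> biconic_sets \<Longrightarrow> N \<in> biconic_sets \<Longrightarrow> M \<inter> N \<in> biconic_sets"
  and biconic_sets_Diff: "M \<in> biconic_sets \<Longrightarrow> N \<in> biconic_sets \<Longrightarrow> M - N \<in> biconic_sets"
  by (auto simp: biconic_sets_iff)

lemma biconic_sets_Compl: "M \<in> biconic_sets \<Longrightarrow> - M \<in> biconic_sets"
  by (auto simp: biconic_sets_iff borel_comp)

lemma biconic_sets_Times:
  fixes K K' :: "(real^'n) set"
  assumes "K \<in> sets borel" "K' \<in> sets borel"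
    and "\<And>s x. s > 0 \<Longrightarrow> s *\<^sub>R x \<in> K \<longleftrightarrow> x \<in> K" "\<And>s x. s > 0 \<Longrightarrow> s *\<^sub>R x \<in> K' \<longleftrightarrow> x \<in> K'"
  shows "K \<times> K' \<in> biconic_sets"
proof -
  have "K \<times> K' \<in> sets borel"
    unfolding borel_prod[symmetric] using assms(1,2) by (rule pair_measureI)
  then show ?thesis using assms(3,4) by (simp add: biconic_sets_iff)
qed

lemma subspace_scaleR_mem_iff:
  assumes "subspace L" "s \<noteq> 0"
  shows "s *\<^sub>R x \<in> L \<longleftrightarrow> x \<in> L"
proof
  assume "s *\<^sub>R x \<in> L"
  then have "inverse s *\<^sub>R (s *\<^sub>R x) \<in> L" using assms(1) by (rule subspace_scale[rotated])
  then show "x \<in> L" using assms(2) by simp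
qed (use assms(1) subspace_scale in blast)

lemma biconic_sets_subspace_Times:
  fixes L L' :: "(real^'n) set"
  assumes "subspace L" "subspace L'"
  shows "L \<times> L' \<in> biconic_sets"
  using assms by (intro biconic_sets_Times) (auto simp: subspace_scaleR_mem_iff closed_subspace borel_closed)

lemma singleton_zero_biconic: "{(0, 0)} \<in> biconic_sets"
  using biconic_sets_subspace_Times[of "{0}" "{0}"] by simp

lemma face_cell_biconic:
  fixes L C :: "(real^'n) set"
  assumes C: "C \<in> polyhedral_cones" and L: "subspace L"
  shows "face_cell C L \<in> biconic_sets"
  unfolding face_cell_def
proof (rule biconic_sets_Times)
  let ?R = "top_of_set L interior_of (C \<inter> L)"
  obtain T where "open T" "?R = T \<inter> L"
    using openin_interior_of[of "top_of_set L" "C \<inter> L"] unfolding openin_open by blast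
  then show "?R \<in> sets borel" using L by (simp add: closed_subspace borel_closed borel_open sets.Int)
  show "polar_cone C \<inter> polar_cone L \<in> sets borel"
    by (intro sets.Int borel_closed closed_polar_cone)
  have sc: "s *\<^sub>R x \<in> ?R" if s: "s > 0" and x: "x \<in> ?R" for s x
  proof -
    obtain e where e: "x \<in> L" "e > 0" "ball x e \<inter> L \<subseteq> C"
      using x by (auto simp: mem_relative_interior_iff)
    have "ball (s *\<^sub>R x) (s * e) \<inter> L \<subseteq> C"
    proof
      fix y assume y: "y \<in> ball (s *\<^sub>R x) (s * e) \<inter> L"
      have "s * norm (x - inverse s *\<^sub>R y) = norm (s *\<^sub>R (x - inverse s *\<^sub>R y))"
        using s by simp
      also have "s *\<^sub>R (x - inverse s *\<^sub>R y) = s *\<^sub>R x - y" using s by (simp add: scaleR_diff_right)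
      finally have "s * norm (x - inverse s *\<^sub>R y) < s * e" using y by (simp add: dist_norm)
      then have "inverse s *\<^sub>R y \<in> ball x e" using s by (simp add: dist_norm)
      moreover have "inverse s *\<^sub>R y \<in> L" using y L by (simp add: subspace_scale)
      ultimately have "inverse s *\<^sub>R y \<in> C" using e by blast
      then have "s *\<^sub>R (inverse s *\<^sub>R y) \<in> C"
        using polyhedral_cone_props(3)[OF C] s unfolding cone_def by (meson less_imp_le)
      then show "y \<in> C" using s by simp
    qed
    then show ?thesis
      using e s L unfolding mem_relative_interior_iff by (meson mult_pos_pos subspace_scale)
  qed
  show "s *\<^sub>R x \<in> ?R \<longleftrightarrow> x \<in> ?R" if "s > 0" for s x
    using sc[of s x] sc[of "inverse s" "s *\<^sub>R x"] that by auto
  have sp: "s *\<^sub>R z \<in> polar_cone D \<longleftrightarrow> z \<in> polar_cone D" if "s > 0" for s z and D :: "(real^'n) set"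
    using scaleR_mem_polar_cone[of z D s] scaleR_mem_polar_cone[of "s *\<^sub>R z" D "inverse s"] that by auto
  then show "s *\<^sub>R z \<in> polar_cone C \<inter> polar_cone L \<longleftrightarrow> z \<in> polar_cone C \<inter> polar_cone L" if "s > 0" for s z
    using that by simp
qed

lemma signed_measure_on_of_biconic_measure:
  fixes \<mu> :: "((real^'n) \<times> (real^'n)) set \<Rightarrow> real"
  assumes "biconic_measure \<mu>"
  shows "signed_measure_on borel (\<lambda>A. \<mu> (sgn_pair -` A))"
  unfolding signed_measure_on_def
proof (intro allI impI)
  fix A :: "nat \<Rightarrow> ((real^'n) \<times> (real^'n)) set"
  assume A: "range A \<subseteq> sets borel" "disjoint_family A"
  let ?B = "\<lambda>i. sgn_pair -` A i"
  have "range ?B \<subseteq> biconic_sets" using A(1) vimage_sgn_pair_biconic by blast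
  moreover have "disjoint_family ?B" using A(2) by (simp add: disjoint_family_on_def flip: vimage_Int)
  ultimately have "(\<lambda>i. \<mu> (?B i)) sums \<mu> (\<Union>i. ?B i)"
    using assms unfolding biconic_measure_def by blast
  then show "(\<lambda>i. \<mu> (sgn_pair -` A i)) sums \<mu> (sgn_pair -` (\<Union>i. A i))"
    by (simp add: vimage_UN)
qed

lemma biconic_measure_empty: "biconic_measure \<mu> \<Longrightarrow> \<mu> {} = 0"
  using signed_measure_on_empty[OF signed_measure_on_of_biconic_measure] by fastforce

lemma biconic_measure_Un:
  assumes "biconic_measure \<mu>" "M \<in> biconic_sets" "N \<in> biconic_sets" "M \<inter> N = {}"
  shows "\<mu> (M \<union> N) = \<mu> M + \<mu> N"
  using signed_measure_on_Un[OF signed_measure_on_of_biconic_measure[OF assms(1)], of M N] assms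
  by (simp add: biconic_sets_borel vimage_sgn_pair_eq vimage_Un)

lemma biconic_sets_UN_finite:
  assumes "finite I" "\<And>i. i \<in> I \<Longrightarrow> M i \<in> biconic_sets"
  shows "(\<Union>i\<in>I. M i) \<in> biconic_sets"
  using assms by (auto simp: biconic_sets_iff intro!: sets.finite_UN)

lemma biconic_measure_UN_finite:
  assumes \<mu>: "biconic_measure \<mu>" and "finite I" "\<And>i. i \<in> I \<Longrightarrow> M i \<in> biconic_sets"
    "disjoint_family_on M I"
  shows "\<mu> (\<Union>i\<in>I. M i) = (\<Sum>i\<in>I. \<mu> (M i))"
  using assms(2-)
proof (induction I)
  case empty
  then show ?case by (simp add: biconic_measure_empty[OF \<mu>])
next
  case (insert i I)
  have "\<mu> (M i \<union> (\<Union>i\<in>I. M i)) = \<mu> (M i) + \<mu> (\<Union>i\<in>I. M i)"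
  proof (rule biconic_measure_Un[OF \<mu>])
    show "M i \<in> biconic_sets" using insert.prems by simp
    show "(\<Union>i\<in>I. M i) \<in> biconic_sets"
      using insert.hyps insert.prems by (intro biconic_sets_UN_finite) auto
    show "M i \<inter> (\<Union>i\<in>I. M i) = {}"
      using insert.hyps insert.prems(2) by (auto simp: disjoint_family_on_def)
  qed
  moreover have "disjoint_family_on M I"
    using insert.prems(2) by (rule disjoint_family_on_mono[rotated]) auto
  ultimately show ?case using insert by simp
qed

section \<open>Orthogonal transformations adapted to a subspace\<close>

definition reflection :: "real^'n \<Rightarrow> real^'n \<Rightarrow> real^'n" where
  "reflection u x = x - (2 * (x \<bullet> u) / (u \<bullet> u)) *\<^sub>R u"

lemma orthogonal_transformation_reflection: "orthogonal_transformation (reflection u)"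
  unfolding orthogonal_transformation_def
proof
  show "linear (reflection u)"
    by (rule linearI)
       (simp_all add: reflection_def inner_add_left scaleR_add_left distrib_left add_divide_distrib
          scaleR_right_diff_distrib)
  show "\<forall>v w. reflection u v \<bullet> reflection u w = v \<bullet> w"
  proof (intro allI)
    fix v w
    show "reflection u v \<bullet> reflection u w = v \<bullet> w"
    proof (cases "u = 0")
      case False
      define a b where "a = 2 * (v \<bullet> u) / (u \<bullet> u)" and "b = 2 * (w \<bullet> u) / (u \<bullet> u)"
      have "reflection u v \<bullet> reflection u w = (v - a *\<^sub>R u) \<bullet> (w - b *\<^sub>R u)"
        by (simp only: reflection_def a_def b_def)
      also have "\<dots> = v \<bullet> w - b * (v \<bullet> u) - a * (w \<bullet> u) + a * (b * (u \<bullet> u))"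
        unfolding inner_commute[of w u] inner_diff_left inner_diff_right inner_scaleR_left
          inner_scaleR_right by (simp add: right_diff_distrib)
      also have "b * (u \<bullet> u) = 2 * (w \<bullet> u)" using False by (simp add: b_def)
      also have "b * (v \<bullet> u) = a * (w \<bullet> u)" by (simp add: a_def b_def)
      finally show ?thesis by simp
    qed (simp add: reflection_def)
  qed
qed

text \<open>
  Vectors of equal norm are exchanged by the reflection in their perpendicular bisector.
\<close>

lemma reflection_swap:
  assumes "norm x = norm y"
  shows "reflection (x - y) x = y"
proof (cases "x = y")
  case False
  have "x \<bullet> x = y \<bullet> y" using assms by (simp add: norm_eq)
  then have "2 * (x \<bullet> (x - y)) = (x - y) \<bullet> (x - y)"
    by (simp add: inner_diff inner_commute)
  then show ?thesis using False by (simp add: reflection_def)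
qed (simp add: reflection_def)

lemma reflection_orthogonal: "x \<bullet> u = 0 \<Longrightarrow> reflection u x = x"
  by (simp add: reflection_def)

lemma reflection_involution: "reflection u (reflection u x) = x"
  by (cases "u = 0") (simp_all add: reflection_def inner_diff algebra_simps)

lemma reflection_image_subspace:
  assumes L: "subspace L" and u: "u \<in> L \<or> u \<in> polar_cone L"
  shows "reflection u ` L = L"
proof -
  have sub: "reflection u x \<in> L" if "x \<in> L" for x
    using u
  proof
    assume "u \<in> L"
    then show ?thesis using L that by (simp add: reflection_def subspace_diff subspace_scale)
  next
    assume "u \<in> polar_cone L"
    then have "x \<bullet> u = 0" using L that by (simp add: polar_cone_subspace)
    then show ?thesis using that by (simp add: reflection_orthogonal)
  qed
  show ?thesis
  proof (intro equalityI subsetI)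
    fix x assume "x \<in> L"
    then show "x \<in> reflection u ` L"
      using sub by (intro image_eqI[of _ _ "reflection u x"]) (simp_all add: reflection_involution)
  qed (use sub in auto)
qed

text \<open>
  One reflection along a vector of \<open>L\<close> adjusts the first component and fixes the second; a
  reflection along a vector of the orthogonal complement then does the converse.
\<close>

lemma transitive_on_products_of_spheres:
  fixes L :: "(real^'n) set"
  assumes L: "subspace L"
    and xz: "x \<in> L" "z \<in> polar_cone L" and xz': "x' \<in> L" "z' \<in> polar_cone L"
    and norms: "norm x = norm x'" "norm z = norm z'"
  obtains f where "orthogonal_transformation f" "f ` L = L" "f x = x'" "f z = z'"
proof
  let ?f = "reflection (z - z') \<circ> reflection (x - x')"
  note L' = subspace_polar_cone_subspace[OF L]
  have orth: "v \<bullet> w = 0" if "v \<in> L" "w \<in> polar_cone L" for v w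
    using that by (simp add: polar_cone_subspace[OF L])
  have u: "x - x' \<in> L" "z - z' \<in> polar_cone L"
    using L L' xz xz' by (simp_all add: subspace_diff)
  show "orthogonal_transformation ?f"
    by (intro orthogonal_transformation_compose orthogonal_transformation_reflection)
  show "?f ` L = L"
    unfolding image_comp[symmetric] using reflection_image_subspace[OF L] u by simp
  show "?f x = x'"
    using u orth[OF xz'(1) u(2)] by (simp add: reflection_swap[OF norms(1)] reflection_orthogonal)
  have "z \<bullet> (x - x') = 0" using orth[OF u(1) xz(2)] by (simp add: inner_commute)
  then show "?f z = z'"
    by (simp add: reflection_swap[OF norms(2)] reflection_orthogonal)
qed

text \<open>
  A linear isometry from \<open>S\<close> onto \<open>T\<close> and one between the orthogonal complements, which again have equal
  dimension, are glued along the orthogonal decomposition.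
\<close>

lemma orthogonal_transformation_between_subspaces:
  fixes S T :: "(real^'n) set"
  assumes S: "subspace S" and T: "subspace T" and d: "dim S = dim T"
  obtains f where "orthogonal_transformation f" "f ` S = T"
proof -
  note S' = subspace_polar_cone_subspace[OF S] and T' = subspace_polar_cone_subspace[OF T]
  have dim_polar: "dim (polar_cone V) + dim V = CARD('n)" if V: "subspace V" for V :: "(real^'n) set"
    using dim_subspace_orthogonal_to_vectors[OF V subspace_UNIV]
    by (simp add: polar_cone_subspace[OF V] orthogonal_def)
  obtain g where g: "linear g" "g ` S = T" "\<And>x. x \<in> S \<Longrightarrow> norm (g x) = norm x"
    using isometries_subspaces[OF S T d] by metis
  have "dim (polar_cone S) = dim (polar_cone T)"
    using dim_polar[OF S] dim_polar[OF T] d by simp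
  then obtain h where h: "linear h" "h ` polar_cone S = polar_cone T"
    "\<And>x. x \<in> polar_cone S \<Longrightarrow> norm (h x) = norm x"
    using isometries_subspaces[OF S' T'] by metis
  define p where "p x = fst (moreau_pair S x)" for x
  define q where "q x = snd (moreau_pair S x)" for x
  note iff = moreau_pair_eq_iff[OF subspace_imp_closed_convex_cone[OF S], unfolded biconic_lift_subspace[OF S]]
  have pq: "p x \<in> S" "q x \<in> polar_cone S" "p x + q x = x" for x
    using iff[of x "p x" "q x"] by (auto simp: p_def q_def)
  have pqI: "p x = a \<and> q x = b" if "a \<in> S" "b \<in> polar_cone S" "a + b = x" for a b x
    using iff[of x a b] that by (simp add: p_def q_def)
  have add: "p (x + y) = p x + p y \<and> q (x + y) = q x + q y" for x y
    by (rule pqI) (simp_all add: subspace_add S S' pq, metis pq(3) add.assoc add.left_commute)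
  have scale: "p (c *\<^sub>R x) = c *\<^sub>R p x \<and> q (c *\<^sub>R x) = c *\<^sub>R q x" for c x
    by (rule pqI) (simp_all add: subspace_scale S S' pq flip: scaleR_add_right)
  define f where "f x = g (p x) + h (q x)" for x
  have "linear f"
    by (rule linearI) (simp_all add: f_def add scale linear_add[OF g(1)] linear_add[OF h(1)]
        linear_scale[OF g(1)] linear_scale[OF h(1)] algebra_simps)
  moreover have "norm (f x) = norm x" for x
  proof -
    have "g (p x) \<in> T" "h (q x) \<in> polar_cone T" using pq g(2) h(2) by blast+
    then have "orthogonal (g (p x)) (h (q x))" "orthogonal (p x) (q x)"
      using pq by (simp_all add: orthogonal_def polar_cone_subspace S T)
    then have "(norm (f x))\<^sup>2 = (norm (p x + q x))\<^sup>2"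
      using pq(1,2) by (simp add: f_def norm_add_Pythagorean g(3) h(3) del: pq(3))
    then show ?thesis by (simp add: pq power2_eq_iff_nonneg)
  qed
  ultimately have "orthogonal_transformation f" by (simp add: orthogonal_transformation)
  moreover have "f x = g x" if "x \<in> S" for x
    using pqI[of x 0 x] that linear_0[OF h(1)] by (simp add: f_def)
  then have "f ` S = T" using g(2) by auto
  ultimately show thesis by (rule that)
qed

section \<open>The generic part of the biconic lift of a subspace\<close>

lemma UNIV_neq_zero: "(UNIV :: (real^'n) set) \<noteq> {0}"
proof
  assume "(UNIV :: (real^'n) set) = {0}"
  then have "axis undefined 1 = (0 :: real^'n)" by blast
  then show False by (simp add: axis_eq_0_iff)
qed

lemma polar_cone_zero: "polar_cone {0} = (UNIV :: (real^'n) set)"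
  by (simp add: polar_cone_def)

lemma polar_cone_UNIV: "polar_cone UNIV = {0 :: real^'n}"
proof -
  have "z = 0" if "z \<in> polar_cone UNIV" for z :: "real^'n"
  proof -
    have "z \<bullet> z \<le> 0" using that by (simp add: polar_cone_def)
    then show ?thesis using inner_gt_zero_iff[of z] by (metis not_less)
  qed
  then show ?thesis using zero_mem_polar_cone by blast
qed

lemma subspace_eq_UNIV_if_polar_cone_trivial:
  fixes L :: "(real^'n) set"
  assumes L: "subspace L" and triv: "polar_cone L = {0}"
  shows "L = UNIV"
proof -
  have "g \<in> L" for g
  proof -
    obtain p q where "moreau_pair L g = (p, q)" by (cases "moreau_pair L g")
    then show "g \<in> L"
      using moreau_pair_eq_iff[OF subspace_imp_closed_convex_cone[OF L]]
        biconic_lift_subspace[OF L] triv by auto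
  qed
  then show ?thesis by blast
qed

lemma subspace_trivial_if_polar_cone_UNIV:
  fixes L :: "(real^'n) set"
  assumes "subspace L" "polar_cone L = UNIV"
  shows "L = {0}"
proof -
  have "x = 0" if "x \<in> L" for x
  proof -
    have "x \<in> polar_cone L" using assms(2) by simp
    then have "x \<bullet> x \<le> 0" using that unfolding polar_cone_def by blast
    then show ?thesis using inner_gt_zero_iff[of x] by (metis not_less)
  qed
  then show ?thesis using subspace_0[OF assms(1)] by blast
qed

text \<open>
  Removing 0 from a nontrivial subspace but keeping \<open>{0}\<close> itself treats all dimensions alike, including
  0 and the full dimension, where one of the two factors is trivial.
\<close>

definition nonzero_part :: "(real^'n) set \<Rightarrow> (real^'n) set" where
  "nonzero_part V = (if V = {0} then {0} else V - {0})"

definition generic_part :: "(real^'n) set \<Rightarrow> ((real^'n) \<times> (real^'n)) set" where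
  "generic_part L = nonzero_part L \<times> nonzero_part (polar_cone L)"

lemma generic_part_biconic:
  assumes L: "subspace L"
  shows "generic_part L \<in> biconic_sets"
  unfolding generic_part_def
  using L subspace_polar_cone_subspace[OF L]
  by (intro biconic_sets_Times)
     (auto simp: nonzero_part_def subspace_scaleR_mem_iff closed_subspace borel_closed)

lemma generic_part_subset: "generic_part L \<subseteq> L \<times> polar_cone L"
proof -
  have "nonzero_part V \<subseteq> V" for V :: "(real^'n) set" by (simp add: nonzero_part_def)
  then show ?thesis unfolding generic_part_def by blast
qed

text \<open>
  A component of \<open>g\<close> vanishes only if \<open>g\<close> lies in the other one of the two complementary subspaces, which is a
  Gaussian null set when it is proper.
\<close>

lemma AE_moreau_pair_generic:
  fixes L :: "(real^'n) set"
  assumes L: "subspace L"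
  shows "AE g in std_gaussian. moreau_pair L g \<in> generic_part L"
proof -
  note L' = subspace_polar_cone_subspace[OF L]
  have "AE g in std_gaussian. L \<noteq> {0} \<longrightarrow> g \<notin> polar_cone L"
    using subspace_trivial_if_polar_cone_UNIV[OF L] AE_std_gaussian_notin_subspace[OF L']
    by (cases "L = {0}") auto
  moreover have "AE g in std_gaussian. polar_cone L \<noteq> {0} \<longrightarrow> g \<notin> L"
    using AE_std_gaussian_notin_subspace[OF L]
    by (cases "L = UNIV") (auto simp: polar_cone_UNIV)
  ultimately show ?thesis
  proof eventually_elim
    case (elim g)
    obtain x z where xz: "moreau_pair L g = (x, z)" by (cases "moreau_pair L g")
    then have x: "x \<in> L" and z: "z \<in> polar_cone L" and g: "g = x + z"
      using moreau_pair_eq_iff[OF subspace_imp_closed_convex_cone[OF L]] biconic_lift_subspace[OF L]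
      by auto
    have "L = {0} \<or> x \<noteq> 0"
    proof (cases "L = {0}")
      case False
      then have "g \<notin> polar_cone L" using elim by blast
      then have "x \<noteq> 0" using z g by auto
      then show ?thesis ..
    qed simp
    then have "x \<in> nonzero_part L" using x by (metis nonzero_part_def Diff_iff singletonD)
    moreover have "polar_cone L = {0} \<or> z \<noteq> 0"
    proof (cases "polar_cone L = {0}")
      case False
      then have "g \<notin> L" using elim by blast
      then have "z \<noteq> 0" using x g by auto
      then show ?thesis ..
    qed simp
    then have "z \<in> nonzero_part (polar_cone L)" using z by (metis nonzero_part_def Diff_iff singletonD)
    ultimately show ?case using xz by (simp add: generic_part_def)
  qed
qed

lemma borel_vimage_moreau_pair:
  fixes L :: "(real^'n) set"
  assumes "subspace L" "M \<in> sets borel"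
  shows "{g. moreau_pair L g \<in> M} \<in> sets borel"
  using measurable_sets[OF borel_measurable_moreau_pair assms(2)] subspace_imp_closed_convex_cone[OF assms(1)]
  by (simp add: vimage_def)

text \<open>
  The normalized points of the generic part: a product of unit spheres, or of a unit sphere and \<open>{0}\<close>. It is a
  single orbit of the orthogonal transformations that preserve \<open>L\<close>.
\<close>

definition unit_orbit :: "(real^'n) set \<Rightarrow> ((real^'n) \<times> (real^'n)) set" where
  "unit_orbit L = {x \<in> L. norm x = (if L = {0} then 0 else 1)} \<times>
     {z \<in> polar_cone L. norm z = (if polar_cone L = {0} then 0 else 1)}"

lemma unit_orbit_borel:
  fixes L :: "(real^'n) set"
  assumes "subspace L"
  shows "unit_orbit L \<in> sets borel"
proof -
  have closed: "closed {x \<in> V. norm x = c}" if "closed V" for V :: "(real^'n) set" and c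
  proof -
    have "{x \<in> V. norm x = c} = V \<inter> {x. norm x = c}" by auto
    moreover have "closed {x :: real^'n. norm x = c}" by (intro closed_Collect_eq continuous_intros)
    ultimately show ?thesis using that by auto
  qed
  show ?thesis
    unfolding unit_orbit_def using assms
    by (intro borel_closed closed_Times closed) (simp_all add: closed_subspace closed_polar_cone)
qed

lemma vimage_sgn_pair_unit_orbit:
  fixes L :: "(real^'n) set"
  assumes L: "subspace L"
  shows "sgn_pair -` unit_orbit L = generic_part L"
proof -
  have sgn_mem: "sgn x \<in> {x \<in> V. norm x = (if V = {0} then 0 else 1)} \<longleftrightarrow> x \<in> nonzero_part V"
    if V: "subspace V" for V and x :: "real^'n"
  proof (cases "x = 0")
    case False
    then have "sgn x \<in> V \<longleftrightarrow> x \<in> V"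
      unfolding sgn_div_norm by (intro subspace_scaleR_mem_iff V) simp
    then show ?thesis using False by (auto simp: nonzero_part_def norm_sgn)
  qed (use subspace_0[OF V] in \<open>auto simp: nonzero_part_def\<close>)
  show ?thesis
  proof (rule set_eqI)
    fix p :: "(real^'n) \<times> (real^'n)"
    obtain x z where p: "p = (x, z)" by (cases p)
    show "p \<in> sgn_pair -` unit_orbit L \<longleftrightarrow> p \<in> generic_part L"
      unfolding p unit_orbit_def generic_part_def vimage_eq sgn_pair_Pair mem_Sigma_iff
        sgn_mem[OF L] sgn_mem[OF subspace_polar_cone_subspace[OF L]] ..
  qed
qed

section \<open>Support measures as sums over cells\<close>

text \<open>
  A cell lies in both biconic lifts, and membership in the lift characterizes the decomposition.
\<close>

lemma moreau_pair_eq_on_face_cell: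
  fixes C L :: "(real^'n) set"
  assumes C: "C \<in> polyhedral_cones" and L: "subspace L" and p: "p \<in> face_cell C L"
  shows "moreau_pair L g = p \<longleftrightarrow> moreau_pair C g = p"
proof -
  obtain x z where xz: "p = (x, z)" by (cases p)
  have "p \<in> biconic_lift C" "p \<in> biconic_lift L"
    using face_cell_subset_biconic_lift[OF L] p by blast+
  then show ?thesis
    using moreau_pair_eq_iff[OF polyhedral_cone_props(1-4)[OF C]]
      moreau_pair_eq_iff[OF subspace_imp_closed_convex_cone[OF L]] xz by simp
qed

text \<open>
  The events that \<open>moreau_pair C g\<close> falls into the cells of dimension \<open>k\<close> are disjoint, and on each of them
  the pair for \<open>C\<close> may be replaced by the pair for the span of the face, to which the formula for
  subspaces refers.
\<close>

lemma support_measure_eq_sum_face_cells: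
  fixes C :: "(real^'n) set"
  assumes C: "C \<in> polyhedral_cones" and M: "M \<in> biconic_sets"
  shows "support_measure k C M =
    (\<Sum>L\<in>face_spans k C. measure std_gaussian {g. moreau_pair L g \<in> M \<inter> face_cell C L})"
proof -
  interpret G: prob_space "std_gaussian :: (real^'n) measure" by (rule prob_space_std_gaussian)
  let ?E = "\<lambda>L. {g. moreau_pair L g \<in> M \<inter> face_cell C L}"
  have E_eq: "?E L = {g. moreau_pair C g \<in> M \<inter> face_cell C L}" if "L \<in> face_spans k C" for L
    using moreau_pair_eq_on_face_cell[OF C face_spans_subspace[OF that]]
    by (intro Collect_cong) (metis Int_iff)
  have "{g. closest_point C g \<in> cone_skeleton k C \<and>
      (closest_point C g, closest_point (polar_cone C) g) \<in> M} = (\<Union>L\<in>face_spans k C. ?E L)"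
    (is "?S = _")
  proof (intro equalityI subsetI)
    fix g assume "g \<in> ?S"
    then obtain L where L: "L \<in> face_spans k C" and "closest_point C g \<in> top_of_set L interior_of (C \<inter> L)"
      and gM: "moreau_pair C g \<in> M"
      by (auto simp: cone_skeleton_def moreau_pair_def)
    moreover have "moreau_pair C g \<in> biconic_lift C"
      using moreau_pair_eq_iff[OF polyhedral_cone_props(1-4)[OF C], of g "fst (moreau_pair C g)" "snd (moreau_pair C g)"]
      by simp
    ultimately have "moreau_pair C g \<in> face_cell C L"
      using biconic_lift_face_cell[OF face_spans_subspace[OF L]] by (simp add: moreau_pair_def)
    then show "g \<in> (\<Union>L\<in>face_spans k C. ?E L)" using L gM E_eq by blast
  next
    fix g assume "g \<in> (\<Union>L\<in>face_spans k C. ?E L)"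
    then obtain L where "L \<in> face_spans k C" "moreau_pair C g \<in> M \<inter> face_cell C L"
      using E_eq by blast
    then show "g \<in> ?S"
      by (auto simp: cone_skeleton_def moreau_pair_def face_cell_def)
  qed
  then have "support_measure k C M = measure std_gaussian (\<Union>L\<in>face_spans k C. ?E L)"
    by (simp add: support_measure_def)
  also have "\<dots> = (\<Sum>L\<in>face_spans k C. measure std_gaussian (?E L))"
  proof (rule G.finite_measure_finite_Union[OF finite_face_spans[OF C]])
    show "?E ` face_spans k C \<subseteq> sets std_gaussian"
    proof (rule image_subsetI)
      fix L assume "L \<in> face_spans k C"
      then have L: "subspace L" by (rule face_spans_subspace)
      show "?E L \<in> sets std_gaussian"
        unfolding sets_std_gaussian
        by (intro borel_vimage_moreau_pair L biconic_sets_borel biconic_sets_Int M face_cell_biconic C)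
    qed
    show "disjoint_family_on ?E (face_spans k C)"
      unfolding disjoint_family_on_def
      using E_eq face_cell_disjoint[of _ k C _ k] by blast
  qed
  finally show ?thesis .
qed

section \<open>Invariant, localized functionals\<close>

locale local_biconic_functional =
  fixes \<psi> :: "(real^'n) set \<Rightarrow> ((real^'n) \<times> (real^'n)) set \<Rightarrow> real"
  assumes meas: "\<And>C. C \<in> polyhedral_cones \<Longrightarrow> biconic_measure (\<psi> C)"
    and conc: "\<And>C M. C \<in> polyhedral_cones \<Longrightarrow> M \<in> biconic_sets \<Longrightarrow>
      \<psi> C M = \<psi> C (M \<inter> biconic_lift C)"
    and orth: "\<And>C M (Q :: real^'n^'n). C \<in> polyhedral_cones \<Longrightarrow> M \<in> biconic_sets \<Longrightarrow>
      orthogonal_matrix Q \<Longrightarrow>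
      \<psi> ((\<lambda>x. Q *v x) ` C) ((\<lambda>(x, y). (Q *v x, Q *v y)) ` M) = \<psi> C M"
    and loc: "\<And>C D M. C \<in> polyhedral_cones \<Longrightarrow> D \<in> polyhedral_cones \<Longrightarrow> M \<in> biconic_sets \<Longrightarrow>
      biconic_lift C \<inter> M = biconic_lift D \<inter> M \<Longrightarrow> \<psi> C M = \<psi> D M"
begin

lemma orthogonal_transformation_invariant:
  assumes f: "orthogonal_transformation f" and C: "C \<in> polyhedral_cones" "M \<in> biconic_sets"
  shows "\<psi> (f ` C) (map_prod f f ` M) = \<psi> C M"
proof -
  have "(*v) (matrix f) = f"
    using f by (simp add: fun_eq_iff orthogonal_transformation_linear matrix_works)
  moreover have "(\<lambda>(x, y). (f x, f y)) = map_prod f f" by auto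
  moreover have "orthogonal_matrix (matrix f)"
    using f by (simp add: orthogonal_transformation_matrix)
  ultimately show ?thesis using orth[OF C, of "matrix f"] by simp
qed

text \<open>
  After normalization \<open>\<psi> L\<close> becomes a signed Borel measure that is invariant under the orthogonal transformations
  preserving \<open>L\<close>. The normalized pair of projections of a Gaussian vector has an invariant law
  concentrated on the orbit \<open>unit_orbit L\<close>, so the two are proportional there.
\<close>

lemma generic_part_formula:
  assumes L: "subspace L" and M: "M \<in> biconic_sets" and sub: "M \<subseteq> generic_part L"
  shows "\<psi> L M = \<psi> L (generic_part L) * measure std_gaussian {g. moreau_pair L g \<in> M}"
proof -
  interpret G: prob_space "std_gaussian :: (real^'n) measure" by (rule prob_space_std_gaussian)
  have poly: "L \<in> polyhedral_cones" by (rule subspace_polyhedral_cone[OF L])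
  let ?n = "\<lambda>g. sgn_pair (moreau_pair L g)"
  define \<gamma> where "\<gamma> = distr std_gaussian borel ?n"
  have n_meas: "?n \<in> borel_measurable borel"
    using subspace_imp_closed_convex_cone[OF L]
    by (intro measurable_compose[OF _ borel_measurable_sgn_pair] borel_measurable_moreau_pair)
  then have n_meas': "?n \<in> measurable std_gaussian borel" by simp
  have \<gamma>_eq: "measure \<gamma> A = measure std_gaussian {g. moreau_pair L g \<in> sgn_pair -` A}"
    if "A \<in> sets borel" for A
    using that n_meas' by (simp add: \<gamma>_def measure_distr vimage_def)
  define \<nu> where "\<nu> A = \<psi> L (sgn_pair -` A)" for A
  define S where "S = unit_orbit L"
  have S: "S \<in> sets borel" "sgn_pair -` S = generic_part L"
    using unit_orbit_borel[OF L] vimage_sgn_pair_unit_orbit[OF L] by (simp_all add: S_def)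
  \<comment> \<open>The same transformation acts on both components, as in the invariance of \<open>\<psi>\<close>.\<close>
  define T where "T = {map_prod f f |f. orthogonal_transformation f \<and> f ` L = L}"
  have A: "M \<inter> S \<in> sets borel" using S biconic_sets_borel[OF M] by simp
  have vimA: "sgn_pair -` (M \<inter> S) = M"
    using sub by (simp add: vimage_Int S(2) vimage_sgn_pair_eq[OF M] Int_absorb2)
  have \<gamma>_S: "measure \<gamma> S = 1"
    unfolding \<gamma>_eq[OF S(1)] S(2)
    using AE_moreau_pair_generic[OF L]
      borel_vimage_moreau_pair[OF L biconic_sets_borel[OF generic_part_biconic[OF L]]]
    by (subst G.prob_eq_1) auto
  have image_borel: "map_prod f f ` A \<in> sets borel"
    if f: "orthogonal_transformation f" and A: "A \<in> sets borel" for f :: "real^'n \<Rightarrow> real^'n" and A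
  proof -
    let ?h = "map_prod (inv f) (inv f)"
    have lin: "linear (inv f)"
      using f by (intro orthogonal_transformation_linear orthogonal_transformation_inv)
    have "continuous_on UNIV ?h"
      unfolding map_prod_def case_prod_unfold
      by (intro continuous_on_Pair linear_continuous_on_compose[OF _ lin] continuous_intros)
    then have "?h -` A \<in> sets borel"
      using measurable_sets[OF borel_measurable_continuous_onI A] by simp
    also have "?h -` A = map_prod f f ` A"
    proof (intro equalityI subsetI)
      fix p assume p: "p \<in> ?h -` A"
      have "p = map_prod f f (?h p)"
        using orthogonal_transformation_surj[OF f] by (cases p) (simp add: surj_f_inv_f)
      then show "p \<in> map_prod f f ` A" using p by (intro image_eqI[of _ _ "?h p"]) auto
    qed (use orthogonal_transformation_inj[OF f] in \<open>auto simp: inv_f_f\<close>)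
    finally show ?thesis .
  qed
  have sgn_comm: "sgn_pair (map_prod f f p) = map_prod f f (sgn_pair p)"
    if "orthogonal_transformation f" for f :: "real^'n \<Rightarrow> real^'n" and p
    using that
    by (cases p) (simp add: sgn_pair_Pair sgn_div_norm orthogonal_transformation_norm
        orthogonal_transformation_scaleR)
  have inj_pair: "map_prod f f p \<in> map_prod f f ` A \<longleftrightarrow> p \<in> A"
    if "orthogonal_transformation f" for f :: "real^'n \<Rightarrow> real^'n" and p A
    using orthogonal_transformation_inj[OF that] by (intro inj_image_mem_iff prod.inj_map)
  have "\<nu> (M \<inter> S) * measure \<gamma> S = measure \<gamma> (M \<inter> S) * \<nu> S"
  proof (rule transitive_invariant_signed_measure_unique[where G = T])
    show "signed_measure_on borel \<nu>"
      unfolding \<nu>_def[abs_def] by (rule signed_measure_on_of_biconic_measure[OF meas[OF poly]])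
    show "finite_measure \<gamma>"
      unfolding \<gamma>_def by (intro G.finite_measure_distr n_meas')
    have "AE g in std_gaussian. ?n g \<in> S"
      using AE_moreau_pair_generic[OF L] S(2) by auto
    then show "AE p in \<gamma>. p \<in> S"
      unfolding \<gamma>_def using S(1) by (subst AE_distr_iff[OF n_meas']) auto
    show "M \<inter> S \<in> sets borel" "M \<inter> S \<subseteq> S" "S \<in> sets borel" using A S by auto
    fix h assume "h \<in> T"
    then obtain f where f: "orthogonal_transformation f" "f ` L = L" and h: "h = map_prod f f"
      by (auto simp: T_def)
    show "surj h" unfolding h using orthogonal_transformation_surj[OF f(1)] by (intro map_prod_surj)
    have dist_f: "dist (f u) (f v) = dist u v" for u v
      using f(1) by (simp add: dist_norm orthogonal_transformation_norm
          flip: linear_diff[OF orthogonal_transformation_linear[OF f(1)]])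
    show "dist (h p) (h q) = dist p q" for p q
      by (cases p; cases q) (simp add: h dist_Pair_Pair dist_f)
    have fp: "f ` polar_cone L = polar_cone L"
      using orthogonal_transformation_image_polar[OF f(1), of L] f(2) by simp
    have sphere: "f ` {x \<in> V. norm x = c} = {x \<in> V. norm x = c}" if V: "f ` V = V" for V c
    proof -
      have "f ` {x \<in> V. norm x = c} = {x \<in> f ` V. norm x = c}"
        using orthogonal_transformation_norm[OF f(1)] by auto
      then show ?thesis using V by simp
    qed
    show "h ` S = S"
      unfolding h S_def unit_orbit_def map_prod_image[symmetric]
      by (simp only: map_prod_image[symmetric] map_prod_surj_on[OF refl refl] sphere[OF f(2)] sphere[OF fp])
    fix A :: "((real^'n) \<times> (real^'n)) set" assume A: "A \<in> sets borel"
    have "sgn_pair -` (h ` A) = h ` (sgn_pair -` A)"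
    proof (intro equalityI subsetI)
      fix p assume p: "p \<in> sgn_pair -` (h ` A)"
      obtain q where q: "p = h q" using \<open>surj h\<close> by blast
      then show "p \<in> h ` (sgn_pair -` A)"
        using p sgn_comm[OF f(1)] inj_pair[OF f(1)] by (simp add: h)
    qed (use sgn_comm[OF f(1)] in \<open>auto simp: h\<close>)
    then show "\<nu> (h ` A) = \<nu> A"
      using orthogonal_transformation_invariant[OF f(1) poly vimage_sgn_pair_biconic[OF A]] f(2)
      by (simp add: \<nu>_def h)
    let ?E = "{g. moreau_pair L g \<in> sgn_pair -` (h ` A)}"
    have hA: "h ` A \<in> sets borel" unfolding h by (rule image_borel[OF f(1) A])
    have "f -` ?E = {g. moreau_pair L g \<in> sgn_pair -` A}"
      using moreau_pair_orthogonal_transformation[OF f(1) L f(2)] sgn_comm[OF f(1)] inj_pair[OF f(1)]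
      by (simp add: h vimage_def)
    moreover have "?E \<in> sets borel"
      by (intro borel_vimage_moreau_pair L biconic_sets_borel vimage_sgn_pair_biconic hA)
    ultimately show "measure \<gamma> (h ` A) = measure \<gamma> A"
      using measure_std_gaussian_orthogonal_vimage[OF f(1), of ?E] by (simp add: \<gamma>_eq[OF hA] \<gamma>_eq[OF A])
  next
    fix p q assume "p \<in> S" "q \<in> S"
    then have "fst p \<in> L" "snd p \<in> polar_cone L" "fst q \<in> L" "snd q \<in> polar_cone L"
      "norm (fst p) = norm (fst q)" "norm (snd p) = norm (snd q)"
      unfolding S_def unit_orbit_def mem_Times_iff by simp_all
    then obtain f where "orthogonal_transformation f" "f ` L = L" "f (fst p) = fst q" "f (snd p) = snd q"
      by (rule transitive_on_products_of_spheres[OF L])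
    then show "\<exists>h\<in>T. h p = q"
      by (intro bexI[of _ "map_prod f f"]) (auto simp: T_def prod_eq_iff)
  qed (simp_all add: \<gamma>_def)
  then show ?thesis
    unfolding \<gamma>_eq[OF A] \<nu>_def vimA S(2) \<gamma>_S by (simp only: mult_1_right mult.commute)
qed

text \<open>
  By locality \<open>L\<close> may be replaced by \<open>{0}\<close> if the first components vanish, and by the whole space if the second
  ones do. For these cones \<open>M\<close> lies in the generic part, and its Gaussian mass is that of a
  proper subspace: the orthogonal complement of \<open>L\<close> in the first case, \<open>L\<close> in the second.
\<close>

lemma degenerate_parts_vanish:
  assumes L: "subspace L" and M: "M \<in> biconic_sets"
    and proper: "L \<noteq> {0}" "polar_cone L \<noteq> {0}"
    and zero: "M \<subseteq> {0} \<times> (polar_cone L - {0}) \<or> M \<subseteq> (L - {0}) \<times> {0}"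
  shows "\<psi> L M = 0"
proof -
  note L' = subspace_polar_cone_subspace[OF L]
  have generic: "generic_part {0} = {0} \<times> (UNIV - {0 :: real^'n})"
    "generic_part UNIV = (UNIV - {0 :: real^'n}) \<times> {0}"
    by (simp_all add: generic_part_def nonzero_part_def polar_cone_zero polar_cone_UNIV UNIV_neq_zero)
  have lift: "biconic_lift {0} = {0} \<times> (UNIV :: (real^'n) set)"
    "biconic_lift UNIV = (UNIV :: (real^'n) set) \<times> {0}" "biconic_lift L = L \<times> polar_cone L"
    using L by (simp_all add: biconic_lift_subspace polar_cone_zero polar_cone_UNIV)
  \<comment> \<open>\<open>K\<close> is the cone of comparison, and \<open>W\<close> the proper subspace that has to contain the Gaussian vector.\<close>
  obtain K and W :: "(real^'n) set" where K: "subspace K" and MK: "M \<subseteq> biconic_lift K" "M \<subseteq> biconic_lift L"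
    "M \<subseteq> generic_part K" and W: "subspace W" "W \<noteq> UNIV"
    and split: "\<And>g. moreau_pair K g \<in> M \<Longrightarrow> g \<in> W"
    using zero
  proof
    assume M0: "M \<subseteq> {0} \<times> (polar_cone L - {0})"
    show thesis
    proof (rule that[of "{0}" "polar_cone L"])
      show "polar_cone L \<noteq> UNIV" using subspace_trivial_if_polar_cone_UNIV[OF L] proper by blast
      show "M \<subseteq> biconic_lift {0}" "M \<subseteq> biconic_lift L" "M \<subseteq> generic_part {0}"
        unfolding lift generic using M0 subspace_0[OF L] by blast+
      fix g assume "moreau_pair {0} g \<in> M"
      moreover obtain x z where xz: "moreau_pair {0} g = (x, z)" by (cases "moreau_pair {0} g")
      moreover have "x + z = g"
        using xz moreau_pair_eq_iff[OF subspace_imp_closed_convex_cone, of "{0}" g x z] by simp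
      ultimately show "g \<in> polar_cone L"
        using M0 by auto
    qed (simp_all add: L')
  next
    assume M0: "M \<subseteq> (L - {0}) \<times> {0}"
    show thesis
    proof (rule that[of UNIV L])
      show "L \<noteq> UNIV" using proper polar_cone_UNIV by auto
      show "M \<subseteq> biconic_lift UNIV" "M \<subseteq> biconic_lift L" "M \<subseteq> generic_part UNIV"
        unfolding lift generic using M0 zero_mem_polar_cone[of L] by blast+
      fix g assume "moreau_pair UNIV g \<in> M"
      moreover obtain x z where xz: "moreau_pair UNIV g = (x, z)" by (cases "moreau_pair UNIV g")
      moreover have "x + z = g"
        using xz moreau_pair_eq_iff[OF subspace_imp_closed_convex_cone, of UNIV g x z] by simp
      ultimately show "g \<in> L"
        using M0 by auto
    qed (simp_all add: L)
  qed
  have "\<psi> L M = \<psi> K M"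
    using MK M by (intro loc subspace_polyhedral_cone L K) auto
  also have "\<dots> = \<psi> K (generic_part K) * measure std_gaussian {g. moreau_pair K g \<in> M}"
    by (rule generic_part_formula[OF K M MK(3)])
  also have "measure std_gaussian {g. moreau_pair K g \<in> M} = 0"
  proof -
    have "AE g in std_gaussian. g \<notin> {g. moreau_pair K g \<in> M}"
      using AE_std_gaussian_notin_subspace[OF W] by eventually_elim (use split in auto)
    then have "{g. moreau_pair K g \<in> M} \<in> null_sets std_gaussian"
      by (subst AE_iff_null_sets) (auto simp: borel_vimage_moreau_pair[OF K biconic_sets_borel[OF M]])
    then show ?thesis by (rule measure_eq_0_null_sets)
  qed
  finally show ?thesis by simp
qed

text \<open>
  The lift of \<open>L\<close> splits into the origin, the generic part and the two degenerate parts, which carry no mass. At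
  the origin locality permits comparison with the whole space.
\<close>

lemma subspace_decomposition:
  assumes L: "subspace L" and M: "M \<in> biconic_sets"
  shows "\<psi> L M = \<psi> UNIV {(0, 0)} * dirac_zero M + \<psi> L (M \<inter> generic_part L)"
proof -
  note L' = subspace_polar_cone_subspace[OF L]
  have poly: "L \<in> polyhedral_cones" by (rule subspace_polyhedral_cone[OF L])
  note \<mu> = meas[OF poly]
  have one: "(0, 0) \<in> L \<times> polar_cone L" using L by (simp add: subspace_0)
  let ?O = "{(0, 0)} :: ((real^'n) \<times> (real^'n)) set"
  \<comment> \<open>Subtracting the generic part matters only if \<open>L\<close> or its complement is trivial; then one of the last
    two sets would otherwise repeat it.\<close>
  let ?A = "M \<inter> generic_part L - ?O"
  let ?B = "M \<inter> ({0} \<times> polar_cone L) - ?O - generic_part L"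
  let ?D = "M \<inter> (L \<times> {0}) - ?O - generic_part L"
  have bic: "?A \<in> biconic_sets" "?B \<in> biconic_sets" "?D \<in> biconic_sets" "M \<inter> ?O \<in> biconic_sets"
    by (intro biconic_sets_Int biconic_sets_Diff biconic_sets_subspace_Times L L' M
        generic_part_biconic[OF L] singleton_zero_biconic subspace_single_0)+
  have both: "L \<noteq> {0} \<or> polar_cone L \<noteq> {0}"
    using subspace_eq_UNIV_if_polar_cone_trivial[OF L] UNIV_neq_zero by auto
  have "generic_part L - ?O = generic_part L"
    using both by (auto simp: generic_part_def nonzero_part_def)
  then have A: "?A = M \<inter> generic_part L" by auto
  have "M \<inter> biconic_lift L = (M \<inter> ?O) \<union> (?A \<union> (?B \<union> ?D))"
    using generic_part_subset[of L] one
    by (auto simp: biconic_lift_subspace[OF L] generic_part_def nonzero_part_def split: if_splits)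
  then have "\<psi> L M = \<psi> L ((M \<inter> ?O) \<union> (?A \<union> (?B \<union> ?D)))"
    using conc[OF poly M] by simp
  also have "\<dots> = \<psi> L (M \<inter> ?O) + (\<psi> L ?A + (\<psi> L ?B + \<psi> L ?D))"
  proof -
    have BD: "?B \<union> ?D \<in> biconic_sets" "?A \<union> (?B \<union> ?D) \<in> biconic_sets"
      using bic by (auto simp: biconic_sets_iff)
    show ?thesis
      using bic BD by (subst biconic_measure_Un[OF \<mu>]; (auto; fail)?)+
  qed
  also have "\<psi> L ?B = 0"
  proof (cases "L = {0}")
    case True
    then have "?B = {}" by (auto simp: generic_part_def nonzero_part_def)
    then show ?thesis using biconic_measure_empty[OF \<mu>] by (simp only:)
  next
    case False
    show ?thesis
    proof (cases "polar_cone L = {0}")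
      case True
      then have "?B = {}" by blast
      then show ?thesis using biconic_measure_empty[OF \<mu>] by (simp only:)
    next
      case nz: False
      show ?thesis using False nz
        by (intro degenerate_parts_vanish[OF L bic(2)] disjI1) auto
    qed
  qed
  also have "\<psi> L ?D = 0"
  proof (cases "polar_cone L = {0}")
    case True
    then have "?D = {}" by (auto simp: generic_part_def nonzero_part_def)
    then show ?thesis using biconic_measure_empty[OF \<mu>] by (simp only:)
  next
    case False
    show ?thesis
    proof (cases "L = {0}")
      case True
      then have "?D = {}" by auto
      then show ?thesis using biconic_measure_empty[OF \<mu>] by (simp only:)
    next
      case nz: False
      show ?thesis using False nz
        by (intro degenerate_parts_vanish[OF L bic(3)] disjI2) auto
    qed
  qed
  also have "\<psi> L (M \<inter> ?O) = \<psi> UNIV {(0, 0)} * dirac_zero M"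
  proof (cases "(0, 0) \<in> M")
    case True
    have "\<psi> L ?O = \<psi> UNIV ?O"
      using one by (intro loc poly subspace_polyhedral_cone singleton_zero_biconic)
        (auto simp: biconic_lift_subspace[OF L] biconic_lift_subspace)
    then show ?thesis using True by (simp add: dirac_zero_def)
  qed (simp add: dirac_zero_def biconic_measure_empty[OF \<mu>])
  finally show ?thesis by (simp add: A)
qed

text \<open>
  The generic part carries the whole Gaussian law, so it may be dropped from the event; and
  its mass under \<open>\<psi> L\<close> is the mass of the complement of the origin.
\<close>

lemma subspace_formula:
  assumes L: "subspace L" and M: "M \<in> biconic_sets"
  shows "\<psi> L M = \<psi> UNIV {(0, 0)} * dirac_zero M
           + \<psi> L (- {(0, 0)}) * measure std_gaussian {g. moreau_pair L g \<in> M}"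
proof -
  note gen = generic_part_biconic[OF L]
  have both: "L \<noteq> {0} \<or> polar_cone L \<noteq> {0}"
    using subspace_eq_UNIV_if_polar_cone_trivial[OF L] UNIV_neq_zero by auto
  have "- {(0, 0)} \<inter> generic_part L = generic_part L"
    using both by (auto simp: generic_part_def nonzero_part_def)
  then have total: "\<psi> L (- {(0, 0)}) = \<psi> L (generic_part L)"
    using subspace_decomposition[OF L biconic_sets_Compl[OF singleton_zero_biconic]]
    by (simp add: dirac_zero_def)
  have "measure std_gaussian {g. moreau_pair L g \<in> M \<inter> generic_part L}
      = measure std_gaussian {g. moreau_pair L g \<in> M}"
    using AE_moreau_pair_generic[OF L] borel_vimage_moreau_pair[OF L biconic_sets_borel[OF M]]
      borel_vimage_moreau_pair[OF L biconic_sets_borel[OF biconic_sets_Int[OF M gen]]]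
    by (intro measure_eq_AE) auto
  then show ?thesis
    using subspace_decomposition[OF L M] generic_part_formula[OF L biconic_sets_Int[OF M gen]] total
    by simp
qed

text \<open>
  This makes the coefficients independent of the position of the subspace.
\<close>

lemma punctured_total_mass_eq:
  assumes L: "subspace L" "subspace L'" "dim L = dim L'"
  shows "\<psi> L (- {(0, 0)}) = \<psi> L' (- {(0, 0)})"
proof -
  obtain f where f: "orthogonal_transformation f" "f ` L = L'"
    using orthogonal_transformation_between_subspaces[OF L] by blast
  have "bij (map_prod f f)"
    using orthogonal_transformation_inj[OF f(1)] orthogonal_transformation_surj[OF f(1)]
    by (intro bijI prod.inj_map map_prod_surj)
  then have "map_prod f f ` (- {(0, 0)}) = - {(0, 0)}"
    using linear_0[OF orthogonal_transformation_linear[OF f(1)]] by (simp add: bij_image_Compl_eq)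
  then show ?thesis
    using orthogonal_transformation_invariant[OF f(1) subspace_polyhedral_cone[OF L(1)]
        biconic_sets_Compl[OF singleton_zero_biconic]] f(2) by simp
qed

text \<open>
  Concentration and additivity reduce \<open>\<psi> C M\<close> to the cells of \<open>C\<close>, where locality permits replacing
  \<open>C\<close> by the span of the face. The Dirac terms add up because the origin lies in exactly one cell.
\<close>

lemma representation:
  assumes Ls: "\<And>k. k \<le> CARD('n) \<Longrightarrow> subspace (L k) \<and> dim (L k) = k"
    and C: "C \<in> polyhedral_cones" and M: "M \<in> biconic_sets"
  shows "\<psi> C M = \<psi> UNIV {(0, 0)} * dirac_zero M
           + (\<Sum>k = 0..CARD('n). \<psi> (L k) (- {(0, 0)}) * support_measure k C M)"
proof -
  \<comment> \<open>The index set records the dimension next to the span, so that the sum over cells splits by dimension.\<close>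
  define I where "I = Sigma {..CARD('n)} (\<lambda>k. face_spans k C)"
  define N where "N i = M \<inter> face_cell C (snd i)" for i :: "nat \<times> (real^'n) set"
  let ?a = "\<psi> UNIV {(0, 0)}" and ?b = "\<lambda>k. \<psi> (L k) (- {(0, 0)})"
  have fin: "finite I"
    unfolding I_def using finite_face_spans[OF C] by (intro finite_SigmaI) auto
  have sub: "subspace (snd i)" if "i \<in> I" for i
    using that face_spans_subspace by (auto simp: I_def)
  have bic: "N i \<in> biconic_sets" if "i \<in> I" for i
    unfolding N_def by (intro biconic_sets_Int M face_cell_biconic C sub that)
  have disj: "disjoint_family_on N I"
    unfolding disjoint_family_on_def
  proof (intro ballI impI)
    fix i j assume i: "i \<in> I" and j: "j \<in> I" and "i \<noteq> j"
    then have "snd i \<noteq> snd j" by (auto simp: I_def dest!: face_spans_dim)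
    moreover have "snd i \<in> face_spans (fst i) C" "snd j \<in> face_spans (fst j) C"
      using i j by (auto simp: I_def)
    ultimately have "face_cell C (snd i) \<inter> face_cell C (snd j) = {}"
      using face_cell_disjoint by blast
    then show "N i \<inter> N j = {}" by (auto simp: N_def)
  qed
  have UN: "M \<inter> biconic_lift C = (\<Union>i\<in>I. N i)"
    unfolding biconic_lift_eq_Union_face_cells[OF C] I_def N_def by (auto simp: Bex_def) blast
  have cell: "\<psi> C (N i) = ?a * dirac_zero (N i)
      + ?b (fst i) * measure std_gaussian {g. moreau_pair (snd i) g \<in> N i}" if i: "i \<in> I" for i
  proof -
    have "\<psi> C (N i) = \<psi> (snd i) (N i)"
      using face_cell_subset_biconic_lift[OF sub[OF i], of C]
      by (intro loc C subspace_polyhedral_cone sub i bic) (auto simp: N_def)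
    moreover have "\<psi> (snd i) (- {(0, 0)}) = ?b (fst i)"
      using Ls[of "fst i"] i face_spans_dim
      by (intro punctured_total_mass_eq sub) (auto simp: I_def)
    ultimately show ?thesis using subspace_formula[OF sub[OF i] bic[OF i]] by simp
  qed
  have "(0, 0) \<in> biconic_lift C"
    using polyhedral_cone_props(4)[OF C] by (simp add: biconic_lift_def)
  then have "dirac_zero M = dirac_zero (\<Union>i\<in>I. N i)"
    unfolding UN[symmetric] by (simp add: dirac_zero_def indicator_def)
  also have "\<dots> = (\<Sum>i\<in>I. dirac_zero (N i))"
    unfolding dirac_zero_def by (rule indicator_UN_disjoint[OF fin disj])
  finally have dirac: "dirac_zero M = (\<Sum>i\<in>I. dirac_zero (N i))" .
  have "\<psi> C M = (\<Sum>i\<in>I. \<psi> C (N i))"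
    using conc[OF C M] biconic_measure_UN_finite[OF meas[OF C] fin bic disj] UN by simp
  also have "\<dots> = ?a * dirac_zero M
      + (\<Sum>i\<in>I. ?b (fst i) * measure std_gaussian {g. moreau_pair (snd i) g \<in> N i})"
    by (simp add: cell dirac sum.distrib sum_distrib_left)
  also have "(\<Sum>i\<in>I. ?b (fst i) * measure std_gaussian {g. moreau_pair (snd i) g \<in> N i})
      = (\<Sum>k = 0..CARD('n). ?b k * support_measure k C M)"
    unfolding I_def N_def atLeast0AtMost support_measure_eq_sum_face_cells[OF C M] sum_distrib_left
    using finite_face_spans[OF C] by (subst sum.Sigma) (auto intro!: sum.cong)
  finally show ?thesis .
qed

end

section \<open>Characterization of the support measures\<close>

theorem theorem3p7:
  fixes \<psi> :: "(real^'n) set \<Rightarrow> ((real^'n) \<times> (real^'n)) set \<Rightarrow> real"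
  assumes meas: "\<And>C. C \<in> polyhedral_cones \<Longrightarrow> biconic_measure (\<psi> C)"
    and conc: "\<And>C M. C \<in> polyhedral_cones \<Longrightarrow> M \<in> biconic_sets \<Longrightarrow>
      \<psi> C M = \<psi> C (M \<inter> biconic_lift C)"
    and orth: "\<And>C M (Q :: real^'n^'n). C \<in> polyhedral_cones \<Longrightarrow> M \<in> biconic_sets \<Longrightarrow>
      orthogonal_matrix Q \<Longrightarrow>
      \<psi> ((\<lambda>x. Q *v x) ` C) ((\<lambda>(x, y). (Q *v x, Q *v y)) ` M) = \<psi> C M"
    and loc: "\<And>C D M. C \<in> polyhedral_cones \<Longrightarrow> D \<in> polyhedral_cones \<Longrightarrow> M \<in> biconic_sets \<Longrightarrow>
      biconic_lift C \<inter> M = biconic_lift D \<inter> M \<Longrightarrow> \<psi> C M = \<psi> D M"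
  shows "(\<exists>(a::real) (b :: nat \<Rightarrow> real). \<forall>C\<in>polyhedral_cones. \<forall>M\<in>biconic_sets.
            \<psi> C M = a * dirac_zero M + (\<Sum>k = 0..CARD('n). b k * support_measure k C M))
       \<and> (\<forall>L :: nat \<Rightarrow> (real^'n) set.
            (\<forall>k\<le>CARD('n). subspace (L k) \<and> dim (L k) = k) \<longrightarrow>
            (\<forall>C\<in>polyhedral_cones. \<forall>M\<in>biconic_sets.
               \<psi> C M = \<psi> UNIV {(0, 0)} * dirac_zero M
                 + (\<Sum>k = 0..CARD('n). \<psi> (L k) (- {(0, 0)}) * support_measure k C M)))"
proof (intro conjI allI impI ballI)
  interpret local_biconic_functional \<psi>
    by unfold_locales (fact meas conc orth loc)+
  have "\<exists>V :: (real^'n) set. k \<le> CARD('n) \<longrightarrow> subspace V \<and> dim V = k" for k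
  proof (cases "k \<le> CARD('n)")
    case True
    then have "k \<le> dim (UNIV :: (real^'n) set)" by simp
    then show ?thesis by (rule choose_subspace_of_subspace) blast
  qed simp
  then obtain L :: "nat \<Rightarrow> (real^'n) set" where L: "\<And>k. k \<le> CARD('n) \<Longrightarrow> subspace (L k) \<and> dim (L k) = k"
    by metis
  show "\<exists>(a::real) (b :: nat \<Rightarrow> real). \<forall>C\<in>polyhedral_cones. \<forall>M\<in>biconic_sets.
      \<psi> C M = a * dirac_zero M + (\<Sum>k = 0..CARD('n). b k * support_measure k C M)"
    by (intro exI[of _ "\<psi> UNIV {(0, 0)}"] exI[of _ "\<lambda>k. \<psi> (L k) (- {(0, 0)})"] ballI representation L)
next
  interpret local_biconic_functional \<psi>
    by unfold_locales (fact meas conc orth loc)+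
  fix L :: "nat \<Rightarrow> (real^'n) set" and C :: "(real^'n) set" and M :: "((real^'n) \<times> (real^'n)) set"
  assume "\<forall>k\<le>CARD('n). subspace (L k) \<and> dim (L k) = k" "C \<in> polyhedral_cones" "M \<in> biconic_sets"
  then show "\<psi> C M = \<psi> UNIV {(0, 0)} * dirac_zero M
      + (\<Sum>k = 0..CARD('n). \<psi> (L k) (- {(0, 0)}) * support_measure k C M)"
    by (intro representation) auto
qed

end
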